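(* Let $\mathcal{A}_j\in\mathbb{S}_+^{n_w}$ be a positive semidefinite matrix, and with the matrices $\mathcal{F},\mathcal{G},\bm{\mathcal{B}}^{(s)},\Sigma_{\bm\epsilon}$ defined in the context (which depend on the realization of the Markov chain $\bm\theta$ and, for $\mathcal{F}$ and $\bm{\mathcal{B}}^{(s)}$, on the policy parameters $\chi$) put $$\mathcal{M}[\chi]=\mathbb{E}[\mathcal{F}+\mathcal{G}],\qquad \mathcal{V}[\chi]=\mathbb{E}\big[(\mathcal{F}+\mathcal{G})^{\mathrm T}\mathcal{A}_j(\mathcal{F}+\mathcal{G})\big]+\mathbb{E}[\mathcal{H}],$$ $$\mathcal{H}=\begin{bmatrix}\mathrm{trace}\big[\bm{\mathcal{B}}^{(s)\mathrm T}\mathcal{A}_j\,\bm{\mathcal{B}}^{(s)}\,\Sigma_{\bm\epsilon}\big] & 0\\ 0&0\end{bmatrix}\in\mathbb{S}^{n_\zeta+1},$$ where the upper left block of $\mathcal{H}$ is $1\times1$ and expectations are over $\bm\theta$. Then $\mathcal{M}$ is affine in $\chi$ and $\mathcal{V}$ is matrix convex in $\chi$, i.e. $\mathcal{V}[\mu\chi+(1-\mu)\hat\chi]\preceq\mu\mathcal{V}[\chi]+(1-\mu)\mathcal{V}[\hat\chi]$ for all policy parameters $\chi,\hat\chi$ and all $\mu\in[0,1]$.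
   Context: $\mathbb{S}^n$ denotes real symmetric $n\times n$ matrices, $\mathbb{S}^n_+$ ($\mathbb{S}^n_{++}$) the positive semidefinite (definite) ones, and $A\preceq B$ means $B-A\in\mathbb{S}^n_+$. Fix positive integers $n_x,n_u,n_d,n_e,n_y,N,m,T$; let $\mathbb{O}=\{1,\dots,m\}$, $n_w=n_xN+n_uN$, $n_\zeta=n_x+Nn_d$, $n_\epsilon=n_x+Nn_e$. Let $\bm\theta=(\theta_0,\dots,\theta_{N-1})$ be a Markov chain in $\mathbb{O}$ with initial distribution $\pi$ and transition matrix $P$, so $\Pr[(\theta_0,\dots,\theta_\tau)]=\big(\prod_{t=0}^{\tau-1}[P]_{\theta_{t+1},\theta_t}\big)\pi_{\theta_0}$. For each $t\in\{0,\dots,N-1\}$ and $\theta\in\mathbb{O}$ fixed matrices are given: $A_t[\theta]\in\mathbb{R}^{n_x\times n_x}$, $B_t[\theta]\in\mathbb{R}^{n_x\times n_u}$, $B_t^{(d)}[\theta]\in\mathbb{R}^{n_x\times n_d}$, $B^{(s)}_t[\theta]\in\mathbb{R}^{n_x\times n_e}$, $C_t[\theta]\in\mathbb{R}^{n_y\times n_x}$, $D^{(d)}_t[\theta]\in\mathbb{R}^{n_y\times n_d}$, $D^{(s)}_t[\theta]\in\mathbb{R}^{n_y\times n_e}$. Also $\Sigma_0\in\mathbb{S}^{n_x}_{++}$ and $\Sigma_{\bm\epsilon}=\begin{bmatrix}\Sigma_0&0\\0&I\end{bmatrix}\in\mathbb{S}^{n_\epsilon}_{++}$. Policy parameters: let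 $\bm\theta_{[t,T]}=(\theta_{\max\{0,t-T\}},\dots,\theta_t)\in\mathbb{O}^{\min\{T+1,t+1\}}$. The policy parameters are maps $h_t:\mathbb{O}^{\min\{T+1,t+1\}}\to\mathbb{R}^{n_u}$ and $H_j^t:\mathbb{O}^{\min\{T+1,t+1\}}\to\mathbb{R}^{n_u\times n_y}$, $0\le j\le t\le N-1$; $\chi$ is the finite-dimensional real vector listing all values of all these maps. For $t\ge\tau$ let $\bm\Gamma[t,\tau]=A_{t-1}[\theta_{t-1}]\cdots A_\tau[\theta_\tau]$ (with $\bm\Gamma[t,t]=I$). Block matrices (block indices $k,j\in\{0,\dots,N-1\}$; blocks not specified are zero): - $\underline{\mathbf A}\in\mathbb{R}^{n_xN\times n_x}$ with $k$-th block $\bm\Gamma[k+1,0]$; - $\underline{\mathbf B},\underline{\mathbf B}^{(d)},\underline{\mathbf B}^{(s)}$ with $(k,j)$ block, for $k\ge j$, equal to $\bm\Gamma[k+1,j+1]B_j[\theta_j]$, $\bm\Gamma[k+1,j+1]B^{(d)}_j[\theta_j]$, $\bm\Gamma[k+1,j+1]B^{(s)}_j[\theta_j]$ respectively; - $\underline{\mathbf C}\in\mathbb{R}^{n_yN\times n_x}$ with $k$-th block $C_k[\theta_k]\bm\Gamma[k,0]$; - $\underline{\mathbf D}^{(d)}$ with $(k,j)$ block $D^{(d)}_j[\theta_j]$ if $k=j$ and $C_k[\theta_k]\bm\Gamma[k,j+1]B^{(d)}_j[\theta_j]$ if $k>j$; $\underline{\mathbf D}^{(s)}$ likewise with superscript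 $(s)$ in place of $(d)$; - $\underline{\mathbf h}\in\mathbb{R}^{n_uN}$ with $k$-th block $h_k[\bm\theta_{[k,T]}]$; $\underline{\mathbf H}\in\mathbb{R}^{n_uN\times n_yN}$ with $(k,j)$ block $H^k_j[\bm\theta_{[k,T]}]$ for $k\ge j$. Define $$\mathcal{F}=\begin{bmatrix}\underline{\mathbf B}\,\underline{\mathbf h}&\underline{\mathbf B}\,\underline{\mathbf H}\,\underline{\mathbf C}&\underline{\mathbf B}\,\underline{\mathbf H}\,\underline{\mathbf D}^{(d)}\\ \underline{\mathbf h}&\underline{\mathbf H}\,\underline{\mathbf C}&\underline{\mathbf H}\,\underline{\mathbf D}^{(d)}\end{bmatrix},\quad \mathcal{G}=\begin{bmatrix}0&\underline{\mathbf A}&\underline{\mathbf B}^{(d)}\\0&0&0\end{bmatrix}\in\mathbb{R}^{n_w\times(n_\zeta+1)},$$ $$\bm{\mathcal{B}}^{(s)}=\begin{bmatrix}\underline{\mathbf B}\,\underline{\mathbf H}\,\underline{\mathbf C}+\underline{\mathbf A}&\underline{\mathbf B}\,\underline{\mathbf H}\,\underline{\mathbf D}^{(s)}+\underline{\mathbf B}^{(s)}\\ \underline{\mathbf H}\,\underline{\mathbf C}&\underline{\mathbf H}\,\underline{\mathbf D}^{(s)}\end{bmatrix}\in\mathbb{R}^{n_w\times n_\epsilon}.$$ *)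

theory Defs
  imports "HOL-Probability.Probability_Measure" "Jordan_Normal_Form.Matrix"
begin

unbundle no vec_syntax
unbundle no inner_syntax

definition sym_mats :: "nat \<Rightarrow> real mat set" where
  "sym_mats n = {A \<in> carrier_mat n n. transpose_mat A = A}"

definition psd_mats :: "nat \<Rightarrow> real mat set" where
  "psd_mats n = {A \<in> sym_mats n. \<forall>x \<in> carrier_vec n. 0 \<le> x \<bullet> (A *\<^sub>v x)}"

definition pd_mats :: "nat \<Rightarrow> real mat set" where
  "pd_mats n = {A \<in> sym_mats n. \<forall>x \<in> carrier_vec n. x \<noteq> 0\<^sub>v n \<longrightarrow> 0 < x \<bullet> (A *\<^sub>v x)}"

definition loewner_le :: "nat \<Rightarrow> real mat \<Rightarrow> real mat \<Rightarrow> bool" where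
  "loewner_le n A B \<longleftrightarrow> A \<in> sym_mats n \<and> B \<in> sym_mats n \<and> B - A \<in> psd_mats n"

definition trace_mat :: "real mat \<Rightarrow> real" where
  "trace_mat A = sum_list (diag_mat A)"

text \<open>Column-wise counterpart of \<^const>\<open>append_rows\<close>.\<close>

definition append_cols :: "real mat \<Rightarrow> real mat \<Rightarrow> real mat" (infixr \<open>@\<^sub>c\<close> 66) where
  "A @\<^sub>c B = four_block_mat A B (0\<^sub>m 0 (dim_col A)) (0\<^sub>m 0 (dim_col B))"

text \<open>The matrix made of \<open>R\<close> by \<open>C\<close> blocks \<open>X k j\<close>, each of size \<open>nr\<close> by \<open>nc\<close>.\<close>

definition block_mat ::
  "nat \<Rightarrow> nat \<Rightarrow> nat \<Rightarrow> nat \<Rightarrow> (nat \<Rightarrow> nat \<Rightarrow> real mat) \<Rightarrow> real mat" where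
  "block_mat R C nr nc X =
     Matrix.mat (nr * R) (nc * C) (\<lambda>(i, j). X (i div nr) (j div nc) $$ (i mod nr, j mod nc))"

text \<open>Here \<open>X\<close> is a linear subspace of the coordinate space of functions \<open>'i \<Rightarrow> real\<close>; affine
  means a constant plus a linear map.\<close>

definition affine_mat_on ::
  "('i \<Rightarrow> real) set \<Rightarrow> nat \<Rightarrow> nat \<Rightarrow> (('i \<Rightarrow> real) \<Rightarrow> real mat) \<Rightarrow> bool" where
  "affine_mat_on X nr nc f \<longleftrightarrow>
     (\<exists>K \<in> carrier_mat nr nc. \<exists>L.
        (\<forall>x \<in> X. L x \<in> carrier_mat nr nc) \<and>
        (\<forall>x \<in> X. \<forall>y \<in> X. L (\<lambda>i. x i + y i) = L x + L y) \<and>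
        (\<forall>c. \<forall>x \<in> X. L (\<lambda>i. c * x i) = c \<cdot>\<^sub>m L x) \<and>
        (\<forall>x \<in> X. f x = K + L x))"

definition mat_expectation ::
  "'w measure \<Rightarrow> nat \<Rightarrow> nat \<Rightarrow> ('w \<Rightarrow> real mat) \<Rightarrow> real mat" where
  "mat_expectation \<Omega> nr nc X =
     Matrix.mat nr nc (\<lambda>(i, j). prob_space.expectation \<Omega> (\<lambda>\<omega>. X \<omega> $$ (i, j)))"

text \<open>A Markov chain \<open>\<theta> 0, \<dots>, \<theta> (n - 1)\<close> in \<open>{1..m}\<close>. The entry \<open>P i j\<close> is the probability
  of moving from \<open>j\<close> to \<open>i\<close>, so it is the columns of \<open>P\<close> that sum to one.\<close>

definition markov_chain ::
  "'w measure \<Rightarrow> nat \<Rightarrow> nat \<Rightarrow> (nat \<Rightarrow> real) \<Rightarrow> (nat \<Rightarrow> nat \<Rightarrow> real)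
     \<Rightarrow> (nat \<Rightarrow> 'w \<Rightarrow> nat) \<Rightarrow> bool" where
  "markov_chain \<Omega> n m \<pi> P \<theta> \<longleftrightarrow>
     prob_space \<Omega> \<and>
     (\<forall>i \<in> {1..m}. 0 \<le> \<pi> i) \<and> (\<Sum>i = 1..m. \<pi> i) = 1 \<and>
     (\<forall>i \<in> {1..m}. \<forall>j \<in> {1..m}. 0 \<le> P i j) \<and> (\<forall>j \<in> {1..m}. (\<Sum>i = 1..m. P i j) = 1) \<and>
     (\<forall>t < n. \<theta> t \<in> measurable \<Omega> (count_space {1..m})) \<and>
     (\<forall>\<tau> < n. \<forall>s. (\<forall>t \<le> \<tau>. s t \<in> {1..m}) \<longrightarrow>
        measure \<Omega> {\<omega> \<in> space \<Omega>. \<forall>t \<le> \<tau>. \<theta> t \<omega> = s t} =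
          (\<Prod>t < \<tau>. P (s (Suc t)) (s t)) * \<pi> (s 0))"

text \<open>In \<open>sA S t i\<close> etc., \<open>t\<close> is the time and \<open>i\<close> the mode.\<close>

record system =
  nx :: nat
  nu :: nat
  nd :: nat
  ne :: nat
  ny :: nat
  hor :: nat  \<comment> \<open>horizon \<open>N\<close>\<close>
  modes :: nat  \<comment> \<open>\<open>m\<close>\<close>
  mem :: nat  \<comment> \<open>policy memory \<open>T\<close>\<close>
  sA :: "nat \<Rightarrow> nat \<Rightarrow> real mat"
  sB :: "nat \<Rightarrow> nat \<Rightarrow> real mat"
  sBd :: "nat \<Rightarrow> nat \<Rightarrow> real mat"
  sBs :: "nat \<Rightarrow> nat \<Rightarrow> real mat"
  sC :: "nat \<Rightarrow> nat \<Rightarrow> real mat"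
  sDd :: "nat \<Rightarrow> nat \<Rightarrow> real mat"
  sDs :: "nat \<Rightarrow> nat \<Rightarrow> real mat"
  Sigma0 :: "real mat"

definition well_formed :: "system \<Rightarrow> bool" where
  "well_formed S \<longleftrightarrow>
     0 < nx S \<and> 0 < nu S \<and> 0 < nd S \<and> 0 < ne S \<and> 0 < ny S \<and>
     0 < hor S \<and> 0 < modes S \<and> 0 < mem S \<and>
     (\<forall>t < hor S. \<forall>i \<in> {1..modes S}.
        sA S t i \<in> carrier_mat (nx S) (nx S) \<and>
        sB S t i \<in> carrier_mat (nx S) (nu S) \<and>
        sBd S t i \<in> carrier_mat (nx S) (nd S) \<and>
        sBs S t i \<in> carrier_mat (nx S) (ne S) \<and>
        sC S t i \<in> carrier_mat (ny S) (nx S) \<and>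
        sDd S t i \<in> carrier_mat (ny S) (nd S) \<and>
        sDs S t i \<in> carrier_mat (ny S) (ne S)) \<and>
     Sigma0 S \<in> pd_mats (nx S)"

definition nw :: "system \<Rightarrow> nat" where
  "nw S = nx S * hor S + nu S * hor S"

definition nzeta :: "system \<Rightarrow> nat" where
  "nzeta S = nx S + hor S * nd S"

definition Sigma_eps :: "system \<Rightarrow> real mat" where
  "Sigma_eps S =
     four_block_mat (Sigma0 S) (0\<^sub>m (nx S) (hor S * ne S))
                    (0\<^sub>m (hor S * ne S) (nx S)) (1\<^sub>m (hor S * ne S))"

text \<open>A parameter vector \<open>\<chi>\<close> assigns a real number to every scalar entry of
  every value of the maps \<open>h_t\<close> and \<open>H_j^t\<close>: \<open>Offset t s i\<close> addresses entry \<open>i\<close> of \<open>h_t[s]\<close>, and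
  \<open>Gain t j s i k\<close> addresses entry \<open>(i, k)\<close> of \<open>H_j^t[s]\<close>. Vectors indexed by the finite set
  \<open>policy_index S\<close> are represented as functions that vanish elsewhere.\<close>

datatype policy_coord = Offset nat "nat list" nat | Gain nat nat "nat list" nat nat

definition histories :: "system \<Rightarrow> nat \<Rightarrow> nat list set" where
  "histories S t = {s. length s = min (mem S + 1) (t + 1) \<and> set s \<subseteq> {1..modes S}}"

definition policy_index :: "system \<Rightarrow> policy_coord set" where
  "policy_index S =
     {Offset t s i | t s i. t < hor S \<and> s \<in> histories S t \<and> i < nu S} \<union>
     {Gain t j s i k | t j s i k.
        t < hor S \<and> j \<le> t \<and> s \<in> histories S t \<and> i < nu S \<and> k < ny S}"

definition policy_space :: "system \<Rightarrow> (policy_coord \<Rightarrow> real) set" where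
  "policy_space S = {\<chi>. \<forall>c. c \<notin> policy_index S \<longrightarrow> \<chi> c = 0}"

definition policy_h :: "system \<Rightarrow> (policy_coord \<Rightarrow> real) \<Rightarrow> nat \<Rightarrow> nat list \<Rightarrow> real Matrix.vec" where
  "policy_h S \<chi> t s = Matrix.vec (nu S) (\<lambda>i. \<chi> (Offset t s i))"

definition policy_H :: "system \<Rightarrow> (policy_coord \<Rightarrow> real) \<Rightarrow> nat \<Rightarrow> nat \<Rightarrow> nat list \<Rightarrow> real mat" where
  "policy_H S \<chi> t j s = Matrix.mat (nu S) (ny S) (\<lambda>(i, k). \<chi> (Gain t j s i k))"

text \<open>In what follows \<open>p\<close> is a realization of the chain, \<open>p t\<close> being the mode at time \<open>t\<close>.
  The truncated subtraction \<open>t - mem S\<close> is \<open>max {0, t - T}\<close>.\<close>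

definition window :: "system \<Rightarrow> (nat \<Rightarrow> nat) \<Rightarrow> nat \<Rightarrow> nat list" where
  "window S p t = map p [t - mem S..<Suc t]"

text \<open>\<open>Gamma S p t \<tau>\<close> is only meaningful for \<open>\<tau> \<le> t\<close>; its other values are not used.\<close>

fun Gamma :: "system \<Rightarrow> (nat \<Rightarrow> nat) \<Rightarrow> nat \<Rightarrow> nat \<Rightarrow> real mat" where
  "Gamma S p 0 \<tau> = 1\<^sub>m (nx S)"
| "Gamma S p (Suc t) \<tau> =
     (if Suc t \<le> \<tau> then 1\<^sub>m (nx S) else sA S t (p t) * Gamma S p t \<tau>)"

definition uA :: "system \<Rightarrow> (nat \<Rightarrow> nat) \<Rightarrow> real mat" where
  "uA S p = block_mat (hor S) 1 (nx S) (nx S) (\<lambda>k _. Gamma S p (k + 1) 0)"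

definition uB :: "system \<Rightarrow> (nat \<Rightarrow> nat) \<Rightarrow> real mat" where
  "uB S p = block_mat (hor S) (hor S) (nx S) (nu S)
     (\<lambda>k j. if j \<le> k then Gamma S p (k + 1) (j + 1) * sB S j (p j) else 0\<^sub>m (nx S) (nu S))"

definition uBd :: "system \<Rightarrow> (nat \<Rightarrow> nat) \<Rightarrow> real mat" where
  "uBd S p = block_mat (hor S) (hor S) (nx S) (nd S)
     (\<lambda>k j. if j \<le> k then Gamma S p (k + 1) (j + 1) * sBd S j (p j) else 0\<^sub>m (nx S) (nd S))"

definition uBs :: "system \<Rightarrow> (nat \<Rightarrow> nat) \<Rightarrow> real mat" where
  "uBs S p = block_mat (hor S) (hor S) (nx S) (ne S)
     (\<lambda>k j. if j \<le> k then Gamma S p (k + 1) (j + 1) * sBs S j (p j) else 0\<^sub>m (nx S) (ne S))"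

definition uC :: "system \<Rightarrow> (nat \<Rightarrow> nat) \<Rightarrow> real mat" where
  "uC S p = block_mat (hor S) 1 (ny S) (nx S) (\<lambda>k _. sC S k (p k) * Gamma S p k 0)"

definition uDd :: "system \<Rightarrow> (nat \<Rightarrow> nat) \<Rightarrow> real mat" where
  "uDd S p = block_mat (hor S) (hor S) (ny S) (nd S)
     (\<lambda>k j. if k = j then sDd S j (p j)
            else if j < k then sC S k (p k) * Gamma S p k (j + 1) * sBd S j (p j)
            else 0\<^sub>m (ny S) (nd S))"

definition uDs :: "system \<Rightarrow> (nat \<Rightarrow> nat) \<Rightarrow> real mat" where
  "uDs S p = block_mat (hor S) (hor S) (ny S) (ne S)
     (\<lambda>k j. if k = j then sDs S j (p j)
            else if j < k then sC S k (p k) * Gamma S p k (j + 1) * sBs S j (p j)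
            else 0\<^sub>m (ny S) (ne S))"

definition uh :: "system \<Rightarrow> (policy_coord \<Rightarrow> real) \<Rightarrow> (nat \<Rightarrow> nat) \<Rightarrow> real mat" where
  "uh S \<chi> p = block_mat (hor S) 1 (nu S) 1
     (\<lambda>k _. mat_of_cols (nu S) [policy_h S \<chi> k (window S p k)])"

definition uH :: "system \<Rightarrow> (policy_coord \<Rightarrow> real) \<Rightarrow> (nat \<Rightarrow> nat) \<Rightarrow> real mat" where
  "uH S \<chi> p = block_mat (hor S) (hor S) (nu S) (ny S)
     (\<lambda>k j. if j \<le> k then policy_H S \<chi> k j (window S p k) else 0\<^sub>m (nu S) (ny S))"

definition calF :: "system \<Rightarrow> (policy_coord \<Rightarrow> real) \<Rightarrow> (nat \<Rightarrow> nat) \<Rightarrow> real mat" where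
  "calF S \<chi> p =
     (uB S p * uh S \<chi> p @\<^sub>c uB S p * uH S \<chi> p * uC S p @\<^sub>c uB S p * uH S \<chi> p * uDd S p)
     @\<^sub>r
     (uh S \<chi> p @\<^sub>c uH S \<chi> p * uC S p @\<^sub>c uH S \<chi> p * uDd S p)"

definition calG :: "system \<Rightarrow> (nat \<Rightarrow> nat) \<Rightarrow> real mat" where
  "calG S p =
     (0\<^sub>m (nx S * hor S) 1 @\<^sub>c uA S p @\<^sub>c uBd S p)
     @\<^sub>r
     0\<^sub>m (nu S * hor S) (1 + nx S + hor S * nd S)"

definition calBs :: "system \<Rightarrow> (policy_coord \<Rightarrow> real) \<Rightarrow> (nat \<Rightarrow> nat) \<Rightarrow> real mat" where
  "calBs S \<chi> p =
     four_block_mat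
       (uB S p * uH S \<chi> p * uC S p + uA S p) (uB S p * uH S \<chi> p * uDs S p + uBs S p)
       (uH S \<chi> p * uC S p)                   (uH S \<chi> p * uDs S p)"

definition calH ::
  "system \<Rightarrow> real mat \<Rightarrow> (policy_coord \<Rightarrow> real) \<Rightarrow> (nat \<Rightarrow> nat) \<Rightarrow> real mat" where
  "calH S Aj \<chi> p =
     four_block_mat
       (Matrix.mat 1 1
          (\<lambda>_. trace_mat (transpose_mat (calBs S \<chi> p) * Aj * calBs S \<chi> p * Sigma_eps S)))
       (0\<^sub>m 1 (nzeta S)) (0\<^sub>m (nzeta S) 1) (0\<^sub>m (nzeta S) (nzeta S))"

definition calM ::
  "system \<Rightarrow> 'w measure \<Rightarrow> (nat \<Rightarrow> 'w \<Rightarrow> nat) \<Rightarrow> (policy_coord \<Rightarrow> real) \<Rightarrow> real mat" where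
  "calM S \<Omega> \<theta> \<chi> =
     mat_expectation \<Omega> (nw S) (nzeta S + 1)
       (\<lambda>\<omega>. calF S \<chi> (\<lambda>t. \<theta> t \<omega>) + calG S (\<lambda>t. \<theta> t \<omega>))"

definition calV ::
  "system \<Rightarrow> 'w measure \<Rightarrow> (nat \<Rightarrow> 'w \<Rightarrow> nat) \<Rightarrow> real mat \<Rightarrow> (policy_coord \<Rightarrow> real) \<Rightarrow> real mat" where
  "calV S \<Omega> \<theta> Aj \<chi> =
     mat_expectation \<Omega> (nzeta S + 1) (nzeta S + 1)
       (\<lambda>\<omega>. transpose_mat (calF S \<chi> (\<lambda>t. \<theta> t \<omega>) + calG S (\<lambda>t. \<theta> t \<omega>)) * Aj *
             (calF S \<chi> (\<lambda>t. \<theta> t \<omega>) + calG S (\<lambda>t. \<theta> t \<omega>))) +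
     mat_expectation \<Omega> (nzeta S + 1) (nzeta S + 1)
       (\<lambda>\<omega>. calH S Aj \<chi> (\<lambda>t. \<theta> t \<omega>))"

end

theory Submission
  imports Defs
begin

text \<open>For each realization of the chain, \<open>\<F>\<close> is linear and \<open>\<B>\<close> is affine in the policy
  parameters. With \<open>Z = \<mu> X + (1 - \<mu>) Y\<close>, the quadratic map \<open>X \<mapsto> X\<^sup>T A X\<close> satisfies
  \<open>\<mu> X\<^sup>T A X + (1 - \<mu>) Y\<^sup>T A Y - Z\<^sup>T A Z = \<mu> (1 - \<mu>) (X - Y)\<^sup>T A (X - Y)\<close>, so it is matrix
  convex, and \<open>tr (X\<^sup>T A X \<Sigma>)\<close> is convex because the trace of a product of two positive
  semidefinite matrices is nonnegative. Expectations over the finitely many realizations preserve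
  linear identities and the Loewner order.\<close>

section \<open>Positive semidefinite matrices\<close>

text \<open>Positivity is handled through finite double sums over index functions. In this form the
  quadratic form is visibly linear in the matrix, so it can be exchanged with an integral, and the
  trace of a product becomes a double sum of the same kind. The trace inequality is the one place
  where two semidefinite matrices interact. Symmetric Gaussian elimination writes one of them as a
  sum of rank one terms \<open>q q^T\<close> with positive weights, and pairing the other matrix
  \<open>A\<close> with such a term gives \<open>q^T A q\<close>, which is nonnegative. Weights that
  sum to one matter for more than the sign: \<open>uA\<close>, \<open>uBs\<close> and
  \<open>calG\<close> do not depend on the policy, and a combination reproduces these constants only
  with such weights. The expectation is an entrywise Bochner integral, a total operator that is
  additive and monotone only on integrable functions. Integrability comes from finiteness: all
  matrices depend on the path only through its values before the horizon.\<close>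

lemma quadratic_form_eq_sum:
  fixes A :: "real mat"
  assumes "A \<in> carrier_mat n n" "x \<in> carrier_vec n"
  shows "x \<bullet> (A *\<^sub>v x) = (\<Sum>i<n. \<Sum>j<n. x $ i * A $$ (i, j) * x $ j)"
proof -
  have "x \<bullet> (A *\<^sub>v x) = (\<Sum>i<n. x $ i * (\<Sum>j<n. A $$ (i, j) * x $ j))"
    using assms by (simp add: scalar_prod_def row_def atLeast0LessThan)
  then show ?thesis
    by (simp add: sum_distrib_left mult.assoc)
qed

lemma sym_matsI:
  assumes "A \<in> carrier_mat n n" "\<And>i j. i < n \<Longrightarrow> j < n \<Longrightarrow> A $$ (i, j) = A $$ (j, i)"
  shows "A \<in> sym_mats n"
proof -
  have "transpose_mat A = A"
    using carrier_matD[OF assms(1)] by (intro eq_matI) (simp_all add: assms(2)[symmetric])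
  then show ?thesis
    using assms(1) by (simp add: sym_mats_def)
qed

text \<open>The test vector is an arbitrary function on the naturals, read only below
  \<open>n\<close>. This avoids dimension side conditions when the form is expanded or
  integrated.\<close>

lemma psd_matsI:
  assumes "A \<in> carrier_mat n n" "\<And>i j. i < n \<Longrightarrow> j < n \<Longrightarrow> A $$ (i, j) = A $$ (j, i)"
    and "\<And>x. 0 \<le> (\<Sum>i<n. \<Sum>j<n. x i * A $$ (i, j) * x j)"
  shows "A \<in> psd_mats n"
proof -
  have "A \<in> sym_mats n"
    by (rule sym_matsI[OF assms(1,2)])
  then show ?thesis
    using assms(1,3) by (auto simp: psd_mats_def quadratic_form_eq_sum)
qed

lemma sym_mats_carrier: "A \<in> sym_mats n \<Longrightarrow> A \<in> carrier_mat n n"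
  by (simp add: sym_mats_def)

lemma psd_mats_carrier: "A \<in> psd_mats n \<Longrightarrow> A \<in> carrier_mat n n"
  by (simp add: psd_mats_def sym_mats_def)

lemma sym_mats_index:
  assumes "A \<in> sym_mats n" "i < n" "j < n"
  shows "A $$ (i, j) = A $$ (j, i)"
  using assms by (metis (mono_tags, lifting) carrier_matD index_transpose_mat(1) mem_Collect_eq sym_mats_def)

lemma psd_mats_sym: "A \<in> psd_mats n \<Longrightarrow> A \<in> sym_mats n"
  by (simp add: psd_mats_def)

lemma psd_mats_quadratic_form:
  assumes "A \<in> psd_mats n"
  shows "0 \<le> (\<Sum>i<n. \<Sum>j<n. x i * A $$ (i, j) * x j)"
proof -
  have "0 \<le> vec n x \<bullet> (A *\<^sub>v vec n x)"
    using assms by (simp add: psd_mats_def)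
  also have "\<dots> = (\<Sum>i<n. \<Sum>j<n. x i * A $$ (i, j) * x j)"
    using assms by (subst quadratic_form_eq_sum[of _ n]) (auto simp: psd_mats_carrier)
  finally show ?thesis .
qed

lemma pd_mats_psd: "A \<in> pd_mats n \<Longrightarrow> A \<in> psd_mats n"
  by (fastforce simp: pd_mats_def psd_mats_def sym_mats_def intro: less_imp_le)

lemma psd_mats_add:
  assumes "A \<in> psd_mats n" "B \<in> psd_mats n"
  shows "A + B \<in> psd_mats n"
proof (rule psd_matsI)
  note car = psd_mats_carrier[OF assms(1)] psd_mats_carrier[OF assms(2)]
  show "A + B \<in> carrier_mat n n"
    using car by auto
  show "(A + B) $$ (i, j) = (A + B) $$ (j, i)" if "i < n" "j < n" for i j
    using car that assms[THEN psd_mats_sym, THEN sym_mats_index, OF that] by auto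
  show "0 \<le> (\<Sum>i<n. \<Sum>j<n. x i * (A + B) $$ (i, j) * x j)" for x
  proof -
    have "(\<Sum>i<n. \<Sum>j<n. x i * (A + B) $$ (i, j) * x j) =
        (\<Sum>i<n. \<Sum>j<n. x i * A $$ (i, j) * x j) + (\<Sum>i<n. \<Sum>j<n. x i * B $$ (i, j) * x j)"
      unfolding sum.distrib[symmetric] using car
      by (intro sum.cong refl) (auto simp: algebra_simps)
    then show ?thesis
      using psd_mats_quadratic_form[OF assms(1)] psd_mats_quadratic_form[OF assms(2)] by simp
  qed
qed

lemma psd_mats_smult:
  assumes "A \<in> psd_mats n" "0 \<le> c"
  shows "c \<cdot>\<^sub>m A \<in> psd_mats n"
proof (rule psd_matsI)
  note car = psd_mats_carrier[OF assms(1)]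
  show "c \<cdot>\<^sub>m A \<in> carrier_mat n n"
    using car by auto
  show "(c \<cdot>\<^sub>m A) $$ (i, j) = (c \<cdot>\<^sub>m A) $$ (j, i)" if "i < n" "j < n" for i j
    using car that sym_mats_index[OF psd_mats_sym[OF assms(1)] that] by auto
  show "0 \<le> (\<Sum>i<n. \<Sum>j<n. x i * (c \<cdot>\<^sub>m A) $$ (i, j) * x j)" for x
  proof -
    have "(\<Sum>i<n. \<Sum>j<n. x i * (c \<cdot>\<^sub>m A) $$ (i, j) * x j) =
        c * (\<Sum>i<n. \<Sum>j<n. x i * A $$ (i, j) * x j)"
      unfolding sum_distrib_left using car
      by (intro sum.cong refl) auto
    then show ?thesis
      using psd_mats_quadratic_form[OF assms(1), of x] assms(2) by simp
  qed
qed

text \<open>Reduces identities between congruences to identities between the summands for each pair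
  \<open>(k, l)\<close>.\<close>

lemma congruence_index:
  fixes A :: "real mat"
  assumes "X \<in> carrier_mat n m" "A \<in> carrier_mat n n" "Y \<in> carrier_mat n m" "i < m" "j < m"
  shows "(transpose_mat X * A * Y) $$ (i, j) =
    (\<Sum>k<n. \<Sum>l<n. X $$ (k, i) * A $$ (k, l) * Y $$ (l, j))"
  using assms
  by (simp add: assoc_mult_mat[of _ m n _ n _ m] scalar_prod_def row_def col_def atLeast0LessThan
      sum_distrib_left mult.assoc)

lemma sym_mats_congruence:
  assumes "A \<in> sym_mats n" "X \<in> carrier_mat n m"
  shows "transpose_mat X * A * X \<in> sym_mats m"
proof -
  have "A \<in> carrier_mat n n" "transpose_mat A = A"
    using assms by (auto simp: sym_mats_def)
  moreover have "transpose_mat (transpose_mat X * (A * X)) = transpose_mat (A * X) * X"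
    using calculation assms(2) by (subst transpose_mult[of _ m n _ m]) auto
  moreover have "transpose_mat (A * X) = transpose_mat X * transpose_mat A"
    using calculation assms(2) by (subst transpose_mult[of _ n n _ m]) auto
  ultimately show ?thesis
    using assms(2) by (simp add: sym_mats_def assoc_mult_mat[of _ m n _ n _ m])
qed

text \<open>The form of the congruence at \<open>x\<close> is the form of \<open>A\<close> at
  \<open>X x\<close>, by moving the transpose across the scalar product.\<close>

lemma psd_mats_congruence:
  assumes A: "A \<in> psd_mats n" and X: "X \<in> carrier_mat n m"
  shows "transpose_mat X * A * X \<in> psd_mats m"
proof -
  have car: "A \<in> carrier_mat n n"
    using A by (rule psd_mats_carrier)
  have "0 \<le> x \<bullet> (transpose_mat X * A * X *\<^sub>v x)" if x: "x \<in> carrier_vec m" for x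
  proof -
    have "transpose_mat X * A * X *\<^sub>v x = transpose_mat X *\<^sub>v (A *\<^sub>v (X *\<^sub>v x))"
      using car X x by (simp add: assoc_mult_mat_vec[of _ m n] assoc_mult_mat_vec[of _ m n _ m])
    moreover have "x \<bullet> (transpose_mat X *\<^sub>v y) = (X *\<^sub>v x) \<bullet> y" if y: "y \<in> carrier_vec n" for y
    proof -
      have "x \<bullet> (transpose_mat X *\<^sub>v y) = (transpose_mat X *\<^sub>v y) \<bullet> x"
        using X x y by (intro comm_scalar_prod[of _ m]) auto
      also have "\<dots> = y \<bullet> (X *\<^sub>v x)"
        using X x y by (intro transpose_vec_mult_scalar[of _ n m]) auto
      also have "\<dots> = (X *\<^sub>v x) \<bullet> y"
        using X x y by (intro comm_scalar_prod[of _ n]) auto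
      finally show ?thesis .
    qed
    ultimately have "x \<bullet> (transpose_mat X * A * X *\<^sub>v x) = (X *\<^sub>v x) \<bullet> (A *\<^sub>v (X *\<^sub>v x))"
      using car X x by simp
    then show ?thesis
      using A X x by (simp add: psd_mats_def)
  qed
  then show ?thesis
    using sym_mats_congruence[OF psd_mats_sym[OF A] X] by (simp add: psd_mats_def)
qed

text \<open>Each step subtracts the rank one matrix \<open>q q\<^sup>T / q\<^sub>k\<close>, where \<open>q\<close> is column \<open>k\<close> of \<open>Q\<close>;
  this kills the \<open>k\<close>-th diagonal entry and keeps the vanishing ones.\<close>

lemma psd_frobenius_nonneg:
  fixes A Q :: "nat \<Rightarrow> nat \<Rightarrow> real"
  assumes A: "\<And>x. 0 \<le> (\<Sum>i<n. \<Sum>j<n. x i * A i j * x j)"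
    and "\<And>i j. i < n \<Longrightarrow> j < n \<Longrightarrow> Q i j = Q j i"
    and "\<And>x. 0 \<le> (\<Sum>i<n. \<Sum>j<n. x i * Q i j * x j)"
  shows "0 \<le> (\<Sum>i<n. \<Sum>j<n. A i j * Q i j)"
  using assms(2,3)
proof (induction "card {i. i < n \<and> Q i i \<noteq> 0}" arbitrary: Q rule: less_induct)
  case less
  note sym = less.prems(1) and pos = less.prems(2)
  \<comment> \<open>Testing on vectors supported on two coordinates shows that a zero on the
    diagonal of \<open>Q\<close> forces the corresponding off-diagonal entries to vanish. This is
    needed in the base case and to control the diagonal of \<open>R\<close>.\<close>
  have two: "0 \<le> a * a * Q i i + 2 * a * b * Q i j + b * b * Q j j"
    if ij: "i < n" "j < n" "i \<noteq> j" for i j a b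
  proof -
    define x where "x k = (if k = i then a else 0) + (if k = j then b else 0)" for k
    have "(\<Sum>k<n. \<Sum>l<n. x k * Q k l * x l) = (\<Sum>k<n. x k * (Q k i * a + Q k j * b))"
    proof (rule sum.cong[OF refl])
      fix k
      have "(\<Sum>l<n. x k * Q k l * x l) =
          (\<Sum>l<n. if l = i then x k * Q k i * a else 0) + (\<Sum>l<n. if l = j then x k * Q k j * b else 0)"
        unfolding sum.distrib[symmetric] by (intro sum.cong refl) (auto simp: x_def[of l for l] algebra_simps)
      then show "(\<Sum>l<n. x k * Q k l * x l) = x k * (Q k i * a + Q k j * b)"
        using ij by (simp add: algebra_simps)
    qed
    also have "\<dots> = (\<Sum>k<n. if k = i then a * (Q i i * a + Q i j * b) else 0) +
        (\<Sum>k<n. if k = j then b * (Q j i * a + Q j j * b) else 0)"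
      unfolding sum.distrib[symmetric] by (intro sum.cong refl) (auto simp: x_def algebra_simps)
    also have "\<dots> = a * a * Q i i + 2 * a * b * Q i j + b * b * Q j j"
      using ij sym[OF ij(1,2)] by (simp add: algebra_simps)
    finally show ?thesis
      using pos[of x] by simp
  qed
  have diag: "0 \<le> Q i i" if "i < n" for i
  proof -
    have "(\<Sum>k<n. \<Sum>l<n. (if k = i then 1 else 0) * Q k l * (if l = i then 1 else 0)) =
        (\<Sum>k<n. if k = i then (\<Sum>l<n. if l = i then Q i i else 0) else 0)"
      by (intro sum.cong refl) (simp add: mult_delta_right)
    then show ?thesis
      using that pos[of "\<lambda>k. if k = i then 1 else 0"] by simp
  qed
  show ?case
  proof (cases "\<exists>k<n. Q k k \<noteq> 0")
    case False
    \<comment> \<open>With zero diagonal, the choices \<open>a = 1\<close>, \<open>b = 1\<close> and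
      \<open>a = 1\<close>, \<open>b = -1\<close> bound \<open>Q i j\<close> from both sides, so
      \<open>Q\<close> is zero.\<close>
    have "Q i j = 0" if "i < n" "j < n" for i j
    proof (cases "i = j")
      case True
      then show ?thesis using that False by auto
    next
      case ne: False
      have "Q i i = 0" "Q j j = 0"
        using that False by auto
      with two[OF that ne, of 1 1] two[OF that ne, of 1 "-1"] show ?thesis by simp
    qed
    then show ?thesis by simp
  next
    case True
    then obtain k where k: "k < n" "Q k k \<noteq> 0" by auto
    have qk: "0 < Q k k" using diag[OF k(1)] k(2) by simp
    define R where "R i j = Q i j - Q i k * Q j k / Q k k" for i j
    have symR: "R i j = R j i" if "i < n" "j < n" for i j
      using sym[OF that] by (simp add: R_def)
    have posR: "0 \<le> (\<Sum>i<n. \<Sum>j<n. x i * R i j * x j)" for x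
    proof -
      define s where "s = (\<Sum>i<n. Q i k * x i)"
      \<comment> \<open>The shift in coordinate \<open>k\<close> is chosen so that coordinate
        \<open>k\<close> of \<open>Q y\<close> vanishes (\<open>s\<close> is that coordinate of
        \<open>Q x\<close>). It minimizes the form over this coordinate, and the minimum is the form
        of \<open>R\<close> at \<open>x\<close>.\<close>
      define y where "y i = x i - (if i = k then s / Q k k else 0)" for i
      have inner: "(\<Sum>j<n. y i * Q i j * y j) = y i * ((\<Sum>j<n. Q i j * x j) - Q i k * s / Q k k)" for i
      proof -
        have "(\<Sum>j<n. y i * Q i j * y j) =
            (\<Sum>j<n. y i * (Q i j * x j)) - (\<Sum>j<n. if j = k then y i * (Q i k * s / Q k k) else 0)"
          unfolding sum_subtractf[symmetric] by (intro sum.cong refl) (auto simp: y_def[of j for j] algebra_simps)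
        then show ?thesis
          using k(1) by (simp add: sum_distrib_left algebra_simps)
      qed
      have s': "(\<Sum>j<n. Q k j * x j) = s"
        unfolding s_def using sym[OF _ k(1)] by (intro sum.cong) auto
      \<comment> \<open>Replacing the left factor \<open>y\<close> by \<open>x\<close> changes only
        the term at \<open>k\<close>, and that term is multiplied by coordinate \<open>k\<close> of
        \<open>Q y\<close>, which is zero.\<close>
      have "(\<Sum>i<n. \<Sum>j<n. y i * Q i j * y j) =
          (\<Sum>i<n. x i * ((\<Sum>j<n. Q i j * x j) - Q i k * s / Q k k)) -
          (\<Sum>i<n. if i = k then s / Q k k * ((\<Sum>j<n. Q k j * x j) - Q k k * s / Q k k) else 0)"
        unfolding inner sum_subtractf[symmetric]
        by (intro sum.cong refl) (auto simp: y_def algebra_simps)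
      also have "\<dots> = (\<Sum>i<n. x i * ((\<Sum>j<n. Q i j * x j) - Q i k * s / Q k k))"
        using k(2) by (simp add: s')
      also have "\<dots> = (\<Sum>i<n. \<Sum>j<n. x i * R i j * x j)"
      proof (rule sum.cong[OF refl])
        fix i
        have "(\<Sum>j<n. Q i j * x j) - Q i k * s / Q k k = (\<Sum>j<n. R i j * x j)"
          unfolding s_def R_def
          by (simp add: left_diff_distrib right_diff_distrib sum_subtractf sum_distrib_left sum_divide_distrib mult_ac)
        then show "x i * ((\<Sum>j<n. Q i j * x j) - Q i k * s / Q k k) = (\<Sum>j<n. x i * R i j * x j)"
          by (simp add: sum_distrib_left mult.assoc)
      qed
      finally show ?thesis using pos[of y] by simp
    qed
    have "R i i = 0" if i: "i < n" and "Q i i = 0" for i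
    proof (cases "i = k")
      case False
      \<comment> \<open>A linear function of \<open>a\<close> that is bounded below is constant. The
        value of \<open>a\<close> chosen next would make the left side equal to
        \<open>- Q k k\<close>, which is negative.\<close>
      have "a * 2 * Q i k + Q k k \<ge> 0" for a
        using two[OF i k(1) False, of a 1] that by (simp add: mult_ac)
      from this[of "- Q k k / Q i k"] qk have "Q i k = 0"
        by (cases "Q i k = 0") (auto simp: field_simps)
      then show ?thesis using that by (simp add: R_def)
    qed (use that k in auto)
    moreover have "R k k = 0" using k by (simp add: R_def)
    ultimately have "{i. i < n \<and> R i i \<noteq> 0} \<subset> {i. i < n \<and> Q i i \<noteq> 0}"
      using k by blast
    then have "card {i. i < n \<and> R i i \<noteq> 0} < card {i. i < n \<and> Q i i \<noteq> 0}"
      by (intro psubset_card_mono) auto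
    from less.hyps[OF this symR posR] have "0 \<le> (\<Sum>i<n. \<Sum>j<n. A i j * R i j)" by blast
    \<comment> \<open>The removed rank one part contributes the form of \<open>A\<close> at column
      \<open>k\<close> of \<open>Q\<close>, divided by the positive pivot.\<close>
    moreover have "(\<Sum>i<n. \<Sum>j<n. A i j * Q i j) =
        (\<Sum>i<n. \<Sum>j<n. A i j * R i j) + (\<Sum>i<n. \<Sum>j<n. Q i k * A i j * Q j k) / Q k k"
      unfolding sum_divide_distrib sum.distrib[symmetric]
      by (intro sum.cong refl) (auto simp: R_def algebra_simps)
    moreover have "0 \<le> (\<Sum>i<n. \<Sum>j<n. Q i k * A i j * Q j k) / Q k k"
      using A[of "\<lambda>i. Q i k"] qk by simp
    ultimately show ?thesis by linarith
  qed
qed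

section \<open>Traces of products\<close>

lemma trace_mat_eq_sum: "A \<in> carrier_mat n n \<Longrightarrow> trace_mat A = (\<Sum>i<n. A $$ (i, i))"
  by (simp add: trace_mat_def diag_mat_def interv_sum_list_conv_sum_set_nat atLeast0LessThan)

lemma trace_mult_eq_sum:
  assumes "A \<in> carrier_mat n n" "B \<in> carrier_mat n n"
  shows "trace_mat (A * B) = (\<Sum>i<n. \<Sum>j<n. A $$ (i, j) * B $$ (j, i))"
  using assms by (simp add: trace_mat_eq_sum[of _ n] scalar_prod_def row_def col_def atLeast0LessThan)

text \<open>The product itself is in general not symmetric, so its trace is treated as the entrywise
  pairing of the two factors; symmetry of \<open>B\<close> makes the transposed index order
  harmless.\<close>

lemma trace_psd_mult_nonneg:
  assumes "A \<in> psd_mats n" "B \<in> psd_mats n"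
  shows "0 \<le> trace_mat (A * B)"
proof -
  note B_sym = sym_mats_index[OF psd_mats_sym[OF assms(2)]]
  have "0 \<le> (\<Sum>i<n. \<Sum>j<n. A $$ (i, j) * B $$ (j, i))"
    by (rule psd_frobenius_nonneg)
      (use psd_mats_quadratic_form[OF assms(1)] psd_mats_quadratic_form[OF assms(2)] B_sym in auto)
  then show ?thesis
    by (simp add: trace_mult_eq_sum[of _ n] psd_mats_carrier assms)
qed

lemma psd_mats_one: "1\<^sub>m n \<in> psd_mats n"
proof -
  have "0 \<le> x \<bullet> x" for x :: "real vec"
    by (simp add: scalar_prod_def sum_nonneg)
  then show ?thesis
    by (simp add: psd_mats_def sym_mats_def)
qed

lemma psd_mats_zero: "0\<^sub>m n n \<in> psd_mats n"
  by (rule psd_matsI) auto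

text \<open>The form splits along \<open>x = y @\<^sub>v z\<close>. It serves both
  \<open>Sigma_eps\<close> (identity as second block) and the matrices that vanish off the upper
  left corner (zero as second block).\<close>

lemma psd_mats_four_block_diag:
  assumes A: "A \<in> psd_mats n" and B: "B \<in> psd_mats m"
  shows "four_block_mat A (0\<^sub>m n m) (0\<^sub>m m n) B \<in> psd_mats (n + m)"
proof -
  let ?D = "four_block_mat A (0\<^sub>m n m) (0\<^sub>m m n) B"
  have car: "A \<in> carrier_mat n n" "B \<in> carrier_mat m m"
    using A B by (auto simp: psd_mats_carrier)
  have "0 \<le> x \<bullet> (?D *\<^sub>v x)" if x: "x \<in> carrier_vec (n + m)" for x
  proof -
    define y z where "y = vec_first x n" and "z = vec_last x m"
    have yz: "y \<in> carrier_vec n" "z \<in> carrier_vec m" "x = y @\<^sub>v z"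
      using x by (auto simp: y_def z_def)
    have "?D *\<^sub>v x = (A *\<^sub>v y) @\<^sub>v (B *\<^sub>v z)"
      using car yz by (simp add: mult_mat_vec_split[of _ n _ m])
    then have "x \<bullet> (?D *\<^sub>v x) = y \<bullet> (A *\<^sub>v y) + z \<bullet> (B *\<^sub>v z)"
      using car yz by (simp add: scalar_prod_append[of _ n _ m])
    then show ?thesis
      using A B yz by (simp add: psd_mats_def)
  qed
  moreover have "transpose_mat ?D = ?D"
    using A B car by (simp add: transpose_four_block_mat[of _ n n _ m _ m] psd_mats_def sym_mats_def)
  ultimately show ?thesis
    using car by (simp add: psd_mats_def sym_mats_def)
qed

section \<open>Block matrices and linear combinations\<close>

lemma block_mat_carrier [simp]: "block_mat R C nr nc X \<in> carrier_mat (nr * R) (nc * C)"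
  by (simp add: block_mat_def)

lemma block_index_less:
  fixes i :: nat
  assumes "i < a * b"
  shows "i div a < b" "i mod a < a"
proof -
  have "0 < a"
    using assms by (cases a) auto
  then show "i mod a < a"
    by simp
  show "i div a < b"
    using assms by (metis less_mult_imp_div_less mult.commute)
qed

lemma block_mat_cong:
  assumes "\<And>k j. k < R \<Longrightarrow> j < C \<Longrightarrow> X k j = Y k j"
  shows "block_mat R C nr nc X = block_mat R C nr nc Y"
  by (rule eq_matI) (simp_all add: block_mat_def assms block_index_less)

lemma block_mat_lincomb:
  assumes "\<And>k j. k < R \<Longrightarrow> j < C \<Longrightarrow> X k j = a \<cdot>\<^sub>m Y k j + b \<cdot>\<^sub>m Z k j"
    and "\<And>k j. k < R \<Longrightarrow> j < C \<Longrightarrow> Y k j \<in> carrier_mat nr nc"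
    and "\<And>k j. k < R \<Longrightarrow> j < C \<Longrightarrow> Z k j \<in> carrier_mat nr nc"
  shows "block_mat R C nr nc X = a \<cdot>\<^sub>m block_mat R C nr nc Y + b \<cdot>\<^sub>m block_mat R C nr nc Z"
proof (rule eq_matI)
  fix i j
  assume "i < dim_row (a \<cdot>\<^sub>m block_mat R C nr nc Y + b \<cdot>\<^sub>m block_mat R C nr nc Z)"
    and "j < dim_col (a \<cdot>\<^sub>m block_mat R C nr nc Y + b \<cdot>\<^sub>m block_mat R C nr nc Z)"
  then have ij: "i < nr * R" "j < nc * C"
    by (simp_all add: block_mat_def)
  note less = block_index_less[OF ij(1)] block_index_less[OF ij(2)]
  show "block_mat R C nr nc X $$ (i, j) =
      (a \<cdot>\<^sub>m block_mat R C nr nc Y + b \<cdot>\<^sub>m block_mat R C nr nc Z) $$ (i, j)"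
    using ij less carrier_matD[OF assms(2)[OF less(1,3)]] carrier_matD[OF assms(3)[OF less(1,3)]]
    by (simp add: block_mat_def assms(1))
qed (simp_all add: block_mat_def)

lemma append_cols_carrier [simp]:
  assumes "A \<in> carrier_mat nr nc1" "B \<in> carrier_mat nr nc2"
  shows "A @\<^sub>c B \<in> carrier_mat nr (nc1 + nc2)"
  using assms by (auto simp: append_cols_def)

lemma one_smult_mat: "1 \<cdot>\<^sub>m A = (A :: real mat)"
  by (rule eq_matI) auto

lemma mult_lincomb_left:
  fixes A :: "real mat"
  assumes "A \<in> carrier_mat nr n" "X \<in> carrier_mat n nc" "Y \<in> carrier_mat n nc"
  shows "A * (a \<cdot>\<^sub>m X + b \<cdot>\<^sub>m Y) = a \<cdot>\<^sub>m (A * X) + b \<cdot>\<^sub>m (A * Y)"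
  using assms
  by (simp add: mult_add_distrib_mat[of A nr n "a \<cdot>\<^sub>m X" nc "b \<cdot>\<^sub>m Y"] mult_smult_distrib[OF assms(1,2)]
      mult_smult_distrib[OF assms(1,3)])

lemma mult_lincomb_right:
  fixes A :: "real mat"
  assumes "A \<in> carrier_mat n nc" "X \<in> carrier_mat nr n" "Y \<in> carrier_mat nr n"
  shows "(a \<cdot>\<^sub>m X + b \<cdot>\<^sub>m Y) * A = a \<cdot>\<^sub>m (X * A) + b \<cdot>\<^sub>m (Y * A)"
  using assms
  by (simp add: add_mult_distrib_mat[of "a \<cdot>\<^sub>m X" nr n "b \<cdot>\<^sub>m Y" A nc]
      mult_smult_assoc_mat[OF assms(2,1)] mult_smult_assoc_mat[OF assms(3,1)])

lemma mult_lincomb_mid: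
  fixes A :: "real mat"
  assumes "A \<in> carrier_mat nr n" "X \<in> carrier_mat n l" "Y \<in> carrier_mat n l" "B \<in> carrier_mat l nc"
  shows "A * (a \<cdot>\<^sub>m X + b \<cdot>\<^sub>m Y) * B = a \<cdot>\<^sub>m (A * X * B) + b \<cdot>\<^sub>m (A * Y * B)"
  unfolding mult_lincomb_left[OF assms(1-3)]
  using assms by (intro mult_lincomb_right) auto

lemma append_cols_lincomb:
  assumes "A \<in> carrier_mat nr nc1" "A' \<in> carrier_mat nr nc1"
    and "B \<in> carrier_mat nr nc2" "B' \<in> carrier_mat nr nc2"
  shows "(a \<cdot>\<^sub>m A + b \<cdot>\<^sub>m A') @\<^sub>c (a \<cdot>\<^sub>m B + b \<cdot>\<^sub>m B') = a \<cdot>\<^sub>m (A @\<^sub>c B) + b \<cdot>\<^sub>m (A' @\<^sub>c B')"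
  using assms by (intro eq_matI) (auto simp: append_cols_def)

lemma four_block_mat_lincomb:
  fixes A :: "real mat"
  assumes "A \<in> carrier_mat nr1 nc1" "A' \<in> carrier_mat nr1 nc1"
    and "B \<in> carrier_mat nr1 nc2" "B' \<in> carrier_mat nr1 nc2"
    and "C \<in> carrier_mat nr2 nc1" "C' \<in> carrier_mat nr2 nc1"
    and "D \<in> carrier_mat nr2 nc2" "D' \<in> carrier_mat nr2 nc2"
  shows "four_block_mat (a \<cdot>\<^sub>m A + b \<cdot>\<^sub>m A') (a \<cdot>\<^sub>m B + b \<cdot>\<^sub>m B')
      (a \<cdot>\<^sub>m C + b \<cdot>\<^sub>m C') (a \<cdot>\<^sub>m D + b \<cdot>\<^sub>m D') =
    a \<cdot>\<^sub>m four_block_mat A B C D + b \<cdot>\<^sub>m four_block_mat A' B' C' D'"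
  using assms by (intro eq_matI) auto

lemma append_rows_lincomb:
  fixes A :: "real mat"
  assumes "A \<in> carrier_mat nr1 nc" "A' \<in> carrier_mat nr1 nc"
    and "B \<in> carrier_mat nr2 nc" "B' \<in> carrier_mat nr2 nc"
  shows "(a \<cdot>\<^sub>m A + b \<cdot>\<^sub>m A') @\<^sub>r (a \<cdot>\<^sub>m B + b \<cdot>\<^sub>m B') = a \<cdot>\<^sub>m (A @\<^sub>r B) + b \<cdot>\<^sub>m (A' @\<^sub>r B')"
  using assms by (intro eq_matI) (auto simp: append_rows_def)

text \<open>The summand \<open>K\<close> splits as \<mu> K + (1 - \<mu>) K, which is why the weights
  are not arbitrary here, unlike in the linear combination rules above.\<close>

lemma convex_comb_add_const:
  fixes A :: "real mat"
  assumes "A \<in> carrier_mat nr nc" "B \<in> carrier_mat nr nc" "K \<in> carrier_mat nr nc"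
  shows "(\<mu> \<cdot>\<^sub>m A + (1 - \<mu>) \<cdot>\<^sub>m B) + K = \<mu> \<cdot>\<^sub>m (A + K) + (1 - \<mu>) \<cdot>\<^sub>m (B + K)"
  using assms by (intro eq_matI) (auto simp: distrib_left left_diff_distrib)

section \<open>The block matrices of the system\<close>

lemma uA_carrier [simp]: "uA S p \<in> carrier_mat (nx S * hor S) (nx S)"
  using block_mat_carrier[of "hor S" 1 "nx S" "nx S"] by (simp add: uA_def)

lemma uB_carrier [simp]: "uB S p \<in> carrier_mat (nx S * hor S) (nu S * hor S)"
  by (simp add: uB_def)

lemma uBd_carrier [simp]: "uBd S p \<in> carrier_mat (nx S * hor S) (nd S * hor S)"
  by (simp add: uBd_def)

lemma uBs_carrier [simp]: "uBs S p \<in> carrier_mat (nx S * hor S) (ne S * hor S)"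
  by (simp add: uBs_def)

lemma uC_carrier [simp]: "uC S p \<in> carrier_mat (ny S * hor S) (nx S)"
  using block_mat_carrier[of "hor S" 1 "ny S" "nx S"] by (simp add: uC_def)

lemma uDd_carrier [simp]: "uDd S p \<in> carrier_mat (ny S * hor S) (nd S * hor S)"
  by (simp add: uDd_def)

lemma uDs_carrier [simp]: "uDs S p \<in> carrier_mat (ny S * hor S) (ne S * hor S)"
  by (simp add: uDs_def)

lemma uh_carrier [simp]: "uh S \<chi> p \<in> carrier_mat (nu S * hor S) 1"
  using block_mat_carrier[of "hor S" 1 "nu S" 1] by (simp add: uh_def)

lemma uH_carrier [simp]: "uH S \<chi> p \<in> carrier_mat (nu S * hor S) (ny S * hor S)"
  by (simp add: uH_def)

lemma block_product_carriers [simp]: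
  "uB S p * uh S \<chi> p \<in> carrier_mat (nx S * hor S) 1"
  "uB S p * uH S \<chi> p * uC S p \<in> carrier_mat (nx S * hor S) (nx S)"
  "uB S p * uH S \<chi> p * uDd S p \<in> carrier_mat (nx S * hor S) (nd S * hor S)"
  "uB S p * uH S \<chi> p * uDs S p \<in> carrier_mat (nx S * hor S) (ne S * hor S)"
  "uH S \<chi> p * uC S p \<in> carrier_mat (nu S * hor S) (nx S)"
  "uH S \<chi> p * uDd S p \<in> carrier_mat (nu S * hor S) (nd S * hor S)"
  "uH S \<chi> p * uDs S p \<in> carrier_mat (nu S * hor S) (ne S * hor S)"
  by (rule mult_carrier_mat uB_carrier uh_carrier uH_carrier uC_carrier uDd_carrier uDs_carrier)+

text \<open>The column count written in the order in which the blocks of \<open>calF\<close> and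
  \<open>calG\<close> are appended, with the product oriented as in
  \<open>block_mat\<close>.\<close>

lemma nzeta_eq: "nzeta S + 1 = 1 + (nx S + nd S * hor S)"
  by (simp add: nzeta_def)

lemma calF_carrier: "calF S \<chi> p \<in> carrier_mat (nw S) (nzeta S + 1)"
  unfolding calF_def nw_def nzeta_eq
  by (intro carrier_append_rows append_cols_carrier block_product_carriers uh_carrier)

lemma calG_carrier: "calG S p \<in> carrier_mat (nw S) (nzeta S + 1)"
proof -
  have "0\<^sub>m (nx S * hor S) 1 @\<^sub>c uA S p @\<^sub>c uBd S p \<in> carrier_mat (nx S * hor S) (1 + (nx S + nd S * hor S))"
    by (intro append_cols_carrier uA_carrier uBd_carrier zero_carrier_mat)
  then show ?thesis
    unfolding calG_def nw_def nzeta_eq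
    by (rule carrier_append_rows) (simp add: mult.commute)
qed

lemma calBs_carrier: "calBs S \<chi> p \<in> carrier_mat (nw S) (nx S + hor S * ne S)"
  unfolding calBs_def nw_def mult.commute[of "hor S" "ne S"]
  by (intro four_block_carrier_mat add_carrier_mat block_product_carriers uA_carrier uBs_carrier)

section \<open>Dependence on the policy parameters for a fixed path\<close>

lemma uh_lincomb:
  "uh S (\<lambda>c. a * \<chi> c + b * \<chi>' c) p = a \<cdot>\<^sub>m uh S \<chi> p + b \<cdot>\<^sub>m uh S \<chi>' p"
  unfolding uh_def
  by (rule block_mat_lincomb) (auto simp: policy_h_def mat_of_cols_def intro!: eq_matI)

lemma uH_lincomb:
  "uH S (\<lambda>c. a * \<chi> c + b * \<chi>' c) p = a \<cdot>\<^sub>m uH S \<chi> p + b \<cdot>\<^sub>m uH S \<chi>' p"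
  unfolding uH_def
  by (rule block_mat_lincomb) (auto simp: policy_H_def intro!: eq_matI)

text \<open>Each block contains exactly one factor \<open>uh\<close> or \<open>uH\<close>, so no
  products of parameters occur and arbitrary weights can be pulled out.\<close>

lemma calF_lincomb:
  "calF S (\<lambda>c. a * \<chi> c + b * \<chi>' c) p = a \<cdot>\<^sub>m calF S \<chi> p + b \<cdot>\<^sub>m calF S \<chi>' p"
  unfolding calF_def uh_lincomb uH_lincomb
    \<comment> \<open>Supplying the carriers turns the conditional rules into plain equations that
      can be used for unfolding.\<close>
    mult_lincomb_left[OF uB_carrier uh_carrier uh_carrier]
    mult_lincomb_mid[OF uB_carrier uH_carrier uH_carrier uC_carrier]
    mult_lincomb_mid[OF uB_carrier uH_carrier uH_carrier uDd_carrier]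
    mult_lincomb_right[OF uC_carrier uH_carrier uH_carrier]
    mult_lincomb_right[OF uDd_carrier uH_carrier uH_carrier]
    append_cols_lincomb[OF block_product_carriers(2) block_product_carriers(2)
      block_product_carriers(3) block_product_carriers(3)]
    append_cols_lincomb[OF block_product_carriers(5) block_product_carriers(5)
      block_product_carriers(6) block_product_carriers(6)]
    append_cols_lincomb[OF block_product_carriers(1) block_product_carriers(1)
      append_cols_carrier[OF block_product_carriers(2,3)]
      append_cols_carrier[OF block_product_carriers(2,3)]]
    append_cols_lincomb[OF uh_carrier uh_carrier
      append_cols_carrier[OF block_product_carriers(5,6)]
      append_cols_carrier[OF block_product_carriers(5,6)]]
  by (rule append_rows_lincomb; (rule append_cols_carrier block_product_carriers uh_carrier)+)

text \<open>The upper blocks carry the constants \<open>uA\<close> and \<open>uBs\<close>, so the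
  map is only affine and the weights have to sum to one.\<close>

lemma calBs_convex_comb:
  "calBs S (\<lambda>c. \<mu> * \<chi> c + (1 - \<mu>) * \<chi>' c) p =
    \<mu> \<cdot>\<^sub>m calBs S \<chi> p + (1 - \<mu>) \<cdot>\<^sub>m calBs S \<chi>' p"
  unfolding calBs_def uH_lincomb
    mult_lincomb_mid[OF uB_carrier uH_carrier uH_carrier uC_carrier]
    mult_lincomb_mid[OF uB_carrier uH_carrier uH_carrier uDs_carrier]
    mult_lincomb_right[OF uC_carrier uH_carrier uH_carrier]
    mult_lincomb_right[OF uDs_carrier uH_carrier uH_carrier]
    convex_comb_add_const[OF block_product_carriers(2) block_product_carriers(2) uA_carrier]
    convex_comb_add_const[OF block_product_carriers(4) block_product_carriers(4) uBs_carrier]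
  by (rule four_block_mat_lincomb; (rule add_carrier_mat block_product_carriers uA_carrier uBs_carrier)+)

text \<open>A path is a function on all naturals, while the chain is described only before the
  horizon. This relation identifies paths that cannot be told apart there; the matrices are shown
  below to respect it.\<close>

definition agree_on_horizon :: "system \<Rightarrow> (nat \<Rightarrow> nat) \<Rightarrow> (nat \<Rightarrow> nat) \<Rightarrow> bool" where
  "agree_on_horizon S p q \<longleftrightarrow> (\<forall>t < hor S. p t = q t)"

lemma agree_on_horizonD: "agree_on_horizon S p q \<Longrightarrow> t < hor S \<Longrightarrow> p t = q t"
  by (simp add: agree_on_horizon_def)

text \<open>The bound \<open>t \<le> hor S\<close> is not strict: \<open>Gamma S p t \<tau>\<close>
  reads only modes before \<open>t\<close>, and the last block row uses
  \<open>t = hor S\<close>.\<close>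

lemma Gamma_cong:
  assumes "agree_on_horizon S p q" "t \<le> hor S"
  shows "Gamma S p t \<tau> = Gamma S q t \<tau>"
  using assms(2) by (induction t) (simp_all add: agree_on_horizonD[OF assms(1)])

lemma window_cong:
  assumes "agree_on_horizon S p q" "t < hor S"
  shows "window S p t = window S q t"
  using assms by (auto simp: window_def agree_on_horizon_def)

lemma system_matrices_cong:
  assumes "agree_on_horizon S p q"
  shows "uA S p = uA S q" "uB S p = uB S q" "uBd S p = uBd S q" "uBs S p = uBs S q"
    "uC S p = uC S q" "uDd S p = uDd S q" "uDs S p = uDs S q"
    "uh S \<chi> p = uh S \<chi> q" "uH S \<chi> p = uH S \<chi> q"
  unfolding uA_def uB_def uBd_def uBs_def uC_def uDd_def uDs_def uh_def uH_def
  \<comment> \<open>The recursion for \<open>Gamma\<close> stays folded, since its occurrences at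
    \<open>k + 1\<close> would otherwise be unfolded before \<open>Gamma_cong\<close> could
    apply.\<close>
  by (rule block_mat_cong,
      simp add: Gamma_cong[OF assms] window_cong[OF assms] agree_on_horizonD[OF assms] del: Gamma.simps)+

lemma calF_cong: "agree_on_horizon S p q \<Longrightarrow> calF S \<chi> p = calF S \<chi> q"
  unfolding calF_def by (simp only: system_matrices_cong)

lemma calG_cong: "agree_on_horizon S p q \<Longrightarrow> calG S p = calG S q"
  unfolding calG_def by (simp only: system_matrices_cong)

lemma calBs_cong: "agree_on_horizon S p q \<Longrightarrow> calBs S \<chi> p = calBs S \<chi> q"
  unfolding calBs_def by (simp only: system_matrices_cong)

lemma calH_cong: "agree_on_horizon S p q \<Longrightarrow> calH S Aj \<chi> p = calH S Aj \<chi> q"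
  unfolding calH_def by (simp only: calBs_cong)

section \<open>Expectations of random matrices\<close>

text \<open>The carrier part lets entries of sums be read as sums of entries; the integrability part
  is what makes the entrywise integrals linear.\<close>

definition mat_integrable :: "'w measure \<Rightarrow> nat \<Rightarrow> nat \<Rightarrow> ('w \<Rightarrow> real mat) \<Rightarrow> bool" where
  "mat_integrable \<Omega> nr nc X \<longleftrightarrow>
     (\<forall>\<omega> \<in> space \<Omega>. X \<omega> \<in> carrier_mat nr nc) \<and>
     (\<forall>i < nr. \<forall>j < nc. integrable \<Omega> (\<lambda>\<omega>. X \<omega> $$ (i, j)))"

lemma mat_expectation_carrier [simp]: "mat_expectation \<Omega> nr nc X \<in> carrier_mat nr nc"
  by (simp add: mat_expectation_def)

text \<open>Stated with \<open>has_bochner_integral\<close> so that integrability and the value of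
  the integral can both be read off.\<close>

lemma mat_integrable_index_lincomb:
  assumes X: "mat_integrable \<Omega> nr nc X" and Y: "mat_integrable \<Omega> nr nc Y"
    and ij: "i < nr" "j < nc"
  shows "has_bochner_integral \<Omega> (\<lambda>\<omega>. (a \<cdot>\<^sub>m X \<omega> + b \<cdot>\<^sub>m Y \<omega>) $$ (i, j))
    (a * (\<integral>\<omega>. X \<omega> $$ (i, j) \<partial>\<Omega>) + b * (\<integral>\<omega>. Y \<omega> $$ (i, j) \<partial>\<Omega>))"
proof -
  have "has_bochner_integral \<Omega> (\<lambda>\<omega>. a * X \<omega> $$ (i, j) + b * Y \<omega> $$ (i, j))
      (a * (\<integral>\<omega>. X \<omega> $$ (i, j) \<partial>\<Omega>) + b * (\<integral>\<omega>. Y \<omega> $$ (i, j) \<partial>\<Omega>))"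
    using X Y ij unfolding mat_integrable_def
    by (intro has_bochner_integral_add has_bochner_integral_mult_right has_bochner_integral_integrable) auto
  moreover have "(a \<cdot>\<^sub>m X \<omega> + b \<cdot>\<^sub>m Y \<omega>) $$ (i, j) = a * X \<omega> $$ (i, j) + b * Y \<omega> $$ (i, j)"
    if "\<omega> \<in> space \<Omega>" for \<omega>
  proof -
    have "X \<omega> \<in> carrier_mat nr nc" "Y \<omega> \<in> carrier_mat nr nc"
      using X Y that by (auto simp: mat_integrable_def)
    then show ?thesis
      using ij by simp
  qed
  ultimately show ?thesis
    by (subst has_bochner_integral_cong) auto
qed

lemma mat_integrable_lincomb:
  assumes X: "mat_integrable \<Omega> nr nc X" and Y: "mat_integrable \<Omega> nr nc Y"
  shows "mat_integrable \<Omega> nr nc (\<lambda>\<omega>. a \<cdot>\<^sub>m X \<omega> + b \<cdot>\<^sub>m Y \<omega>)"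
proof -
  have "integrable \<Omega> (\<lambda>\<omega>. (a \<cdot>\<^sub>m X \<omega> + b \<cdot>\<^sub>m Y \<omega>) $$ (i, j))" if "i < nr" "j < nc" for i j
    using mat_integrable_index_lincomb[OF X Y that] by (rule integrable.intros)
  then show ?thesis
    using X Y unfolding mat_integrable_def by (blast intro: add_carrier_mat smult_carrier_mat)
qed

lemma mat_expectation_lincomb:
  assumes "mat_integrable \<Omega> nr nc X" "mat_integrable \<Omega> nr nc Y"
  shows "mat_expectation \<Omega> nr nc (\<lambda>\<omega>. a \<cdot>\<^sub>m X \<omega> + b \<cdot>\<^sub>m Y \<omega>) =
    a \<cdot>\<^sub>m mat_expectation \<Omega> nr nc X + b \<cdot>\<^sub>m mat_expectation \<Omega> nr nc Y"
  using has_bochner_integral_integral_eq[OF mat_integrable_index_lincomb[OF assms]]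
  by (intro eq_matI) (simp_all add: mat_expectation_def)

lemma mat_expectation_add:
  assumes "mat_integrable \<Omega> nr nc X" "mat_integrable \<Omega> nr nc Y"
  shows "mat_expectation \<Omega> nr nc (\<lambda>\<omega>. X \<omega> + Y \<omega>) = mat_expectation \<Omega> nr nc X + mat_expectation \<Omega> nr nc Y"
  using mat_expectation_lincomb[OF assms, of 1 1] by (simp add: one_smult_mat)

section \<open>Integrability of functions of the chain\<close>

lemma markov_chain_measurable:
  assumes "markov_chain \<Omega> n m \<pi> P \<theta>" "t < n"
  shows "\<theta> t \<in> measurable \<Omega> (count_space {1..m})"
proof -
  note c = assms(1)[unfolded markov_chain_def]
  note c2 = c[THEN conjunct2, THEN conjunct2, THEN conjunct2, THEN conjunct2, THEN conjunct2, THEN conjunct1]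
  show ?thesis
    by (rule c2[THEN spec, THEN mp, OF assms(2)])
qed

lemma markov_chain_prob_space:
  assumes "markov_chain \<Omega> n m \<pi> P \<theta>"
  shows "prob_space \<Omega>"
  using assms unfolding markov_chain_def by (rule conjunct1)

text \<open>The path restricted to the times below \<open>n\<close> is a random element of a finite
  set. On a finite discrete space every function is measurable and bounded, and a bounded measurable
  function is integrable under a probability measure.\<close>

lemma integrable_path_functional:
  fixes f :: "(nat \<Rightarrow> nat) \<Rightarrow> real"
  assumes chain: "markov_chain \<Omega> n m \<pi> P \<theta>"
    and cong: "\<And>p q. (\<forall>t < n. p t = q t) \<Longrightarrow> f p = f q"
  shows "integrable \<Omega> (\<lambda>\<omega>. f (\<lambda>t. \<theta> t \<omega>))"
proof -
  interpret prob_space \<Omega>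
    using chain by (rule markov_chain_prob_space)
  let ?paths = "{..<n} \<rightarrow>\<^sub>E {1..m}"
  \<comment> \<open>Restriction sets the values from \<open>n\<close> on to
    \<open>undefined\<close>, so the path becomes an element of the finite set \<open>?paths\<close>
    without changing \<open>f\<close>.\<close>
  let ?r = "\<lambda>\<omega>. restrict (\<lambda>t. \<theta> t \<omega>) {..<n}"
  note meas = markov_chain_measurable[OF chain]
  have fin: "finite ?paths"
    by (intro finite_PiE) auto
  \<comment> \<open>For a finite target, measurability needs checking only on singletons, whose
    preimages are finite intersections of events on single times.\<close>
  have "?r -` {s} \<inter> space \<Omega> \<in> sets \<Omega>" if s: "s \<in> ?paths" for s
  proof -
    have "?r -` {s} \<inter> space \<Omega> = {\<omega> \<in> space \<Omega>. \<forall>t \<in> {..<n}. \<theta> t \<omega> = s t}"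
    proof -
      have "?r \<omega> = s \<longleftrightarrow> (\<forall>t \<in> {..<n}. \<theta> t \<omega> = s t)" for \<omega>
      proof
        assume "\<forall>t \<in> {..<n}. \<theta> t \<omega> = s t"
        then have "?r \<omega> = restrict s {..<n}"
          by (intro restrict_ext) auto
        then show "?r \<omega> = s"
          by (simp only: PiE_restrict[OF s])
      next
        assume "?r \<omega> = s"
        then show "\<forall>t \<in> {..<n}. \<theta> t \<omega> = s t"
          by (auto dest: fun_cong)
      qed
      then show ?thesis by blast
    qed
    also have "\<dots> \<in> sets \<Omega>"
    proof (rule sets.sets_Collect_finite_All)
      fix t assume t: "t \<in> {..<n}"
      then have "t < n" by simp
      moreover have "{s t} \<in> sets (count_space {1..m})"
        using PiE_mem[OF s t] by simp
      ultimately have "\<theta> t -` {s t} \<inter> space \<Omega> \<in> sets \<Omega>"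
        by (rule measurable_sets[OF meas])
      moreover have "{\<omega> \<in> space \<Omega>. \<theta> t \<omega> = s t} = \<theta> t -` {s t} \<inter> space \<Omega>"
        by blast
      ultimately show "{\<omega> \<in> space \<Omega>. \<theta> t \<omega> = s t} \<in> sets \<Omega>"
        by (simp only:)
    qed simp
    finally show ?thesis .
  qed
  moreover have range: "?r \<omega> \<in> ?paths" if "\<omega> \<in> space \<Omega>" for \<omega>
    using measurable_space[OF meas that] by auto
  ultimately have "?r \<in> measurable \<Omega> (count_space ?paths)"
    unfolding measurable_count_space_eq2[OF fin] by blast
  then have "(\<lambda>\<omega>. f (?r \<omega>)) \<in> borel_measurable \<Omega>"
    by (rule measurable_compose[OF _ borel_measurable_count_space])
  moreover have "norm (f (?r \<omega>)) \<le> Max ((\<lambda>s. norm (f s)) ` ?paths)" if "\<omega> \<in> space \<Omega>" for \<omega>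
    by (rule Max_ge[OF finite_imageI[OF fin] imageI[OF range[OF that]]])
  ultimately have "integrable \<Omega> (\<lambda>\<omega>. f (?r \<omega>))"
    by (intro integrable_const_bound[of _ "Max ((\<lambda>s. norm (f s)) ` ?paths)"] AE_I2)
  moreover have "f (?r \<omega>) = f (\<lambda>t. \<theta> t \<omega>)" for \<omega>
    by (rule cong) simp
  ultimately show ?thesis by (simp only:)
qed

lemma mat_expectation_sym:
  assumes "\<And>\<omega>. \<omega> \<in> space \<Omega> \<Longrightarrow> X \<omega> \<in> sym_mats n"
  shows "mat_expectation \<Omega> n n X \<in> sym_mats n"
proof (rule sym_matsI)
  fix i j assume ij: "i < n" "j < n"
  have "(\<integral>\<omega>. X \<omega> $$ (i, j) \<partial>\<Omega>) = (\<integral>\<omega>. X \<omega> $$ (j, i) \<partial>\<Omega>)"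
    by (intro Bochner_Integration.integral_cong refl sym_mats_index[OF assms ij])
  then show "mat_expectation \<Omega> n n X $$ (i, j) = mat_expectation \<Omega> n n X $$ (j, i)"
    using ij by (simp add: mat_expectation_def)
qed simp

text \<open>For a fixed test function the form of the difference of expectations is the expectation
  of the form of \<open>Y - X\<close>, a nonnegative random variable.\<close>

lemma mat_expectation_mono:
  assumes X: "mat_integrable \<Omega> n n X" and Y: "mat_integrable \<Omega> n n Y"
    and le: "\<And>\<omega>. \<omega> \<in> space \<Omega> \<Longrightarrow> loewner_le n (X \<omega>) (Y \<omega>)"
  shows "loewner_le n (mat_expectation \<Omega> n n X) (mat_expectation \<Omega> n n Y)"
proof -
  let ?EX = "mat_expectation \<Omega> n n X" and ?EY = "mat_expectation \<Omega> n n Y"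
  have sym: "?EX \<in> sym_mats n" "?EY \<in> sym_mats n"
    using le by (auto simp: loewner_le_def intro!: mat_expectation_sym)
  have "?EY - ?EX \<in> psd_mats n"
  proof (rule psd_matsI)
    show "?EY - ?EX \<in> carrier_mat n n"
      by (rule minus_carrier_mat[OF mat_expectation_carrier])
    show "(?EY - ?EX) $$ (i, j) = (?EY - ?EX) $$ (j, i)" if "i < n" "j < n" for i j
      using sym[THEN sym_mats_index, OF that] that carrier_matD[OF mat_expectation_carrier[of \<Omega> n n X]]
      by simp
    show "0 \<le> (\<Sum>i<n. \<Sum>j<n. x i * (?EY - ?EX) $$ (i, j) * x j)" for x
    proof -
      have int: "integrable \<Omega> (\<lambda>\<omega>. X \<omega> $$ (i, j))" "integrable \<Omega> (\<lambda>\<omega>. Y \<omega> $$ (i, j))"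
        if "i < n" "j < n" for i j
        using X Y that by (auto simp: mat_integrable_def)
      have "(\<Sum>i<n. \<Sum>j<n. x i * (?EY - ?EX) $$ (i, j) * x j) =
          (\<Sum>i<n. \<Sum>j<n. \<integral>\<omega>. x i * (Y \<omega> $$ (i, j) - X \<omega> $$ (i, j)) * x j \<partial>\<Omega>)"
        by (intro sum.cong refl) (simp add: int mat_expectation_def)
      also have "\<dots> = (\<integral>\<omega>. (\<Sum>i<n. \<Sum>j<n. x i * (Y \<omega> $$ (i, j) - X \<omega> $$ (i, j)) * x j) \<partial>\<Omega>)"
      proof -
        have "integrable \<Omega> (\<lambda>\<omega>. x i * (Y \<omega> $$ (i, j) - X \<omega> $$ (i, j)) * x j)"
          if "i \<in> {..<n}" "j \<in> {..<n}" for i j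
          using int that by simp
        then have "has_bochner_integral \<Omega>
            (\<lambda>\<omega>. \<Sum>i<n. \<Sum>j<n. x i * (Y \<omega> $$ (i, j) - X \<omega> $$ (i, j)) * x j)
            (\<Sum>i<n. \<Sum>j<n. \<integral>\<omega>. x i * (Y \<omega> $$ (i, j) - X \<omega> $$ (i, j)) * x j \<partial>\<Omega>)"
          by (intro has_bochner_integral_sum has_bochner_integral_integrable)
        then show ?thesis
          by (rule has_bochner_integral_integral_eq[symmetric])
      qed
      also have "\<dots> \<ge> 0"
      proof (rule Bochner_Integration.integral_nonneg)
        fix \<omega> assume \<omega>: "\<omega> \<in> space \<Omega>"
        have car: "X \<omega> \<in> carrier_mat n n" "Y \<omega> \<in> carrier_mat n n"
          using X Y \<omega> by (auto simp: mat_integrable_def)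
        have "0 \<le> (\<Sum>i<n. \<Sum>j<n. x i * (Y \<omega> - X \<omega>) $$ (i, j) * x j)"
          using le[OF \<omega>] by (intro psd_mats_quadratic_form) (simp add: loewner_le_def)
        also have "\<dots> = (\<Sum>i<n. \<Sum>j<n. x i * (Y \<omega> $$ (i, j) - X \<omega> $$ (i, j)) * x j)"
          using car by (intro sum.cong refl) simp
        finally show "0 \<le> (\<Sum>i<n. \<Sum>j<n. x i * (Y \<omega> $$ (i, j) - X \<omega> $$ (i, j)) * x j)" .
      qed
      finally show ?thesis .
    qed
  qed
  then show ?thesis
    using sym by (simp add: loewner_le_def)
qed

section \<open>Convexity of quadratic matrix functions\<close>

text \<open>\<open>loewner_le\<close> includes symmetry of both sides, so symmetry has to be carried
  through every combination.\<close>

lemma sym_mats_lincomb: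
  assumes "A \<in> sym_mats n" "B \<in> sym_mats n"
  shows "a \<cdot>\<^sub>m A + b \<cdot>\<^sub>m B \<in> sym_mats n"
proof (rule sym_matsI)
  note car = assms[THEN sym_mats_carrier]
  show "a \<cdot>\<^sub>m A + b \<cdot>\<^sub>m B \<in> carrier_mat n n"
    using car by auto
  show "(a \<cdot>\<^sub>m A + b \<cdot>\<^sub>m B) $$ (i, j) = (a \<cdot>\<^sub>m A + b \<cdot>\<^sub>m B) $$ (j, i)" if "i < n" "j < n" for i j
    using car that assms[THEN sym_mats_index, OF that] by simp
qed

lemma loewner_le_add:
  assumes "loewner_le n A B" "loewner_le n C D"
  shows "loewner_le n (A + C) (B + D)"
proof -
  note sym = assms[unfolded loewner_le_def]
  have car: "A \<in> carrier_mat n n" "B \<in> carrier_mat n n" "C \<in> carrier_mat n n" "D \<in> carrier_mat n n"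
    using sym by (auto simp: sym_mats_carrier)
  have "A + C \<in> sym_mats n" "B + D \<in> sym_mats n"
    using sym sym_mats_lincomb[of A n C 1 1] sym_mats_lincomb[of B n D 1 1] by (auto simp: one_smult_mat)
  moreover have "B + D - (A + C) = (B - A) + (D - C)"
    using car by (intro eq_matI) auto
  ultimately show ?thesis
    using sym psd_mats_add by (simp add: loewner_le_def)
qed

lemma congruence_convexity_gap:
  fixes A :: "real mat" and \<mu> :: real
  assumes A: "A \<in> carrier_mat n n" and X: "X \<in> carrier_mat n m" and Y: "Y \<in> carrier_mat n m"
  defines "Z \<equiv> \<mu> \<cdot>\<^sub>m X + (1 - \<mu>) \<cdot>\<^sub>m Y"
  shows "\<mu> \<cdot>\<^sub>m (transpose_mat X * A * X) + (1 - \<mu>) \<cdot>\<^sub>m (transpose_mat Y * A * Y) -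
      transpose_mat Z * A * Z =
    (\<mu> * (1 - \<mu>)) \<cdot>\<^sub>m (transpose_mat (X - Y) * A * (X - Y))" (is "?L = ?R")
proof -
  have Z: "Z \<in> carrier_mat n m" and D: "X - Y \<in> carrier_mat n m"
    using X Y by (auto simp: Z_def)
  define Q where "Q M = transpose_mat M * A * M" for M
  have Q: "Q M \<in> carrier_mat m m" if "M \<in> carrier_mat n m" for M
    using that A by (auto simp: Q_def)
  have "\<mu> \<cdot>\<^sub>m Q X + (1 - \<mu>) \<cdot>\<^sub>m Q Y - Q Z = (\<mu> * (1 - \<mu>)) \<cdot>\<^sub>m Q (X - Y)"
  proof (rule eq_matI)
    fix i j
    assume "i < dim_row ((\<mu> * (1 - \<mu>)) \<cdot>\<^sub>m Q (X - Y))" "j < dim_col ((\<mu> * (1 - \<mu>)) \<cdot>\<^sub>m Q (X - Y))"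
    then have ij: "i < m" "j < m"
      using Q[OF D] by auto
    have "(\<mu> \<cdot>\<^sub>m Q X + (1 - \<mu>) \<cdot>\<^sub>m Q Y - Q Z) $$ (i, j) =
        \<mu> * Q X $$ (i, j) + (1 - \<mu>) * Q Y $$ (i, j) - Q Z $$ (i, j)"
      using ij Q[OF X] Q[OF Y] Q[OF Z] by simp
    \<comment> \<open>For each pair \<open>(k, l)\<close> this is \<open>A $$ (k, l)\<close> times
      the bilinear scalar identity \<mu> x x' + (1 - \<mu>) y y' - z z' = \<mu> (1 - \<mu>) (x - y)
      (x' - y'), where z and z' are the combinations of x, y and of x', y'.\<close>
    also have "\<dots> = (\<mu> * (1 - \<mu>)) * Q (X - Y) $$ (i, j)"
      unfolding Q_def congruence_index[OF X A X ij] congruence_index[OF Y A Y ij]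
        congruence_index[OF Z A Z ij] congruence_index[OF D A D ij]
        sum_distrib_left sum.distrib[symmetric] sum_subtractf[symmetric]
    proof (intro sum.cong refl)
      fix k l assume kl: "k \<in> {..<n}" "l \<in> {..<n}"
      have entries: "Z $$ (k, i) = \<mu> * X $$ (k, i) + (1 - \<mu>) * Y $$ (k, i)"
        "Z $$ (l, j) = \<mu> * X $$ (l, j) + (1 - \<mu>) * Y $$ (l, j)"
        "(X - Y) $$ (k, i) = X $$ (k, i) - Y $$ (k, i)"
        "(X - Y) $$ (l, j) = X $$ (l, j) - Y $$ (l, j)"
        using X Y ij kl by (auto simp: Z_def)
      show "\<mu> * (X $$ (k, i) * A $$ (k, l) * X $$ (l, j)) +
          (1 - \<mu>) * (Y $$ (k, i) * A $$ (k, l) * Y $$ (l, j)) -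
          Z $$ (k, i) * A $$ (k, l) * Z $$ (l, j) =
          \<mu> * (1 - \<mu>) * ((X - Y) $$ (k, i) * A $$ (k, l) * (X - Y) $$ (l, j))"
        unfolding entries by (simp add: algebra_simps)
    qed
    also have "\<dots> = ((\<mu> * (1 - \<mu>)) \<cdot>\<^sub>m Q (X - Y)) $$ (i, j)"
      using ij Q[OF D] by simp
    finally show "(\<mu> \<cdot>\<^sub>m Q X + (1 - \<mu>) \<cdot>\<^sub>m Q Y - Q Z) $$ (i, j) =
      ((\<mu> * (1 - \<mu>)) \<cdot>\<^sub>m Q (X - Y)) $$ (i, j)" .
  qed (use Q[OF D] Q[OF Z] in auto)
  then show ?thesis
    by (simp add: Q_def)
qed

lemma congruence_convex:
  fixes \<mu> :: real
  assumes A: "A \<in> psd_mats n" and X: "X \<in> carrier_mat n m" and Y: "Y \<in> carrier_mat n m"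
    and \<mu>: "\<mu> \<in> {0..1}"
  defines "Z \<equiv> \<mu> \<cdot>\<^sub>m X + (1 - \<mu>) \<cdot>\<^sub>m Y"
  shows "loewner_le m (transpose_mat Z * A * Z)
    (\<mu> \<cdot>\<^sub>m (transpose_mat X * A * X) + (1 - \<mu>) \<cdot>\<^sub>m (transpose_mat Y * A * Y))"
proof -
  have Z: "Z \<in> carrier_mat n m" and D: "X - Y \<in> carrier_mat n m"
    using X Y by (auto simp: Z_def)
  \<comment> \<open>The bounds on \<mu> enter here, through the sign of the factor \<mu> (1 -
    \<mu>).\<close>
  have "(\<mu> * (1 - \<mu>)) \<cdot>\<^sub>m (transpose_mat (X - Y) * A * (X - Y)) \<in> psd_mats m"
    using \<mu> by (intro psd_mats_smult psd_mats_congruence[OF A D]) auto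
  then show ?thesis
    unfolding loewner_le_def congruence_convexity_gap[OF psd_mats_carrier[OF A] X Y, of \<mu>, folded Z_def]
    by (intro conjI sym_mats_lincomb sym_mats_congruence[OF psd_mats_sym[OF A]] X Y Z)
qed

text \<open>Turns the matrix inequality of \<open>congruence_convex\<close> into a scalar one for
  the trace term: the difference of the two sides is the trace of
  \<open>(B - A) * \<Sigma>\<close>.\<close>

lemma trace_mult_mono:
  assumes le: "loewner_le n A B" and \<Sigma>: "\<Sigma> \<in> psd_mats n"
  shows "trace_mat (A * \<Sigma>) \<le> trace_mat (B * \<Sigma>)"
proof -
  have car: "A \<in> carrier_mat n n" "B \<in> carrier_mat n n" "\<Sigma> \<in> carrier_mat n n"
    using le \<Sigma> by (auto simp: loewner_le_def sym_mats_carrier psd_mats_carrier)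
  have "0 \<le> trace_mat ((B - A) * \<Sigma>)"
    using le \<Sigma> by (intro trace_psd_mult_nonneg) (auto simp: loewner_le_def)
  also have "(B - A) * \<Sigma> = B * \<Sigma> - A * \<Sigma>"
    using car by (intro minus_mult_distrib_mat)
  also have "trace_mat (B * \<Sigma> - A * \<Sigma>) = trace_mat (B * \<Sigma>) - trace_mat (A * \<Sigma>)"
    using car minus_carrier_mat[of "A * \<Sigma>" n n "B * \<Sigma>"]
    by (simp add: trace_mat_eq_sum[of _ n] sum_subtractf)
  finally show ?thesis by simp
qed

lemma trace_mult_lincomb:
  assumes "A \<in> carrier_mat n n" "B \<in> carrier_mat n n" "\<Sigma> \<in> carrier_mat n n"
  shows "trace_mat ((a \<cdot>\<^sub>m A + b \<cdot>\<^sub>m B) * \<Sigma>) = a * trace_mat (A * \<Sigma>) + b * trace_mat (B * \<Sigma>)"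
  unfolding mult_lincomb_right[OF assms(3,1,2)]
  using assms by (simp add: trace_mat_eq_sum[of _ n] sum.distrib sum_distrib_left)

section \<open>The mean and the second moment\<close>

lemma Sigma_eps_psd:
  assumes "well_formed S"
  shows "Sigma_eps S \<in> psd_mats (nx S + hor S * ne S)"
  unfolding Sigma_eps_def
proof (intro psd_mats_four_block_diag psd_mats_one pd_mats_psd)
  show "Sigma0 S \<in> pd_mats (nx S)"
    by (rule assms[unfolded well_formed_def, THEN conjunct2, THEN conjunct2, THEN conjunct2,
          THEN conjunct2, THEN conjunct2, THEN conjunct2, THEN conjunct2, THEN conjunct2, THEN conjunct2])
qed

lemma calH_carrier: "calH S Aj \<chi> p \<in> carrier_mat (nzeta S + 1) (nzeta S + 1)"
  unfolding calH_def add.commute[of "nzeta S" 1]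
  by (rule four_block_carrier_mat) simp_all

text \<open>\<open>calH\<close> depends on the policy through one scalar placed in a corner. Since
  \<open>corner\<close> is linear, and positive semidefinite at nonnegative arguments, the Loewner
  inequality reduces to convexity of the scalar \<open>tr\<close>.\<close>

lemma calH_convex:
  assumes "well_formed S" and Aj: "Aj \<in> psd_mats (nw S)" and \<mu>: "\<mu> \<in> {0..1}"
  shows "loewner_le (nzeta S + 1) (calH S Aj (\<lambda>c. \<mu> * \<chi> c + (1 - \<mu>) * \<chi>' c) p)
    (\<mu> \<cdot>\<^sub>m calH S Aj \<chi> p + (1 - \<mu>) \<cdot>\<^sub>m calH S Aj \<chi>' p)"
proof -
  let ?n = "nx S + hor S * ne S"
  define corner :: "real \<Rightarrow> real mat" where "corner t =
    four_block_mat (Matrix.mat 1 1 (\<lambda>_. t)) (0\<^sub>m 1 (nzeta S)) (0\<^sub>m (nzeta S) 1) (0\<^sub>m (nzeta S) (nzeta S))" for t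
  define tr where "tr \<chi> = trace_mat (transpose_mat (calBs S \<chi> p) * Aj * calBs S \<chi> p * Sigma_eps S)" for \<chi>
  have H: "calH S Aj \<chi> p = corner (tr \<chi>)" for \<chi>
    by (simp add: calH_def corner_def tr_def)
  have corner_psd: "corner t \<in> psd_mats (nzeta S + 1)" if "0 \<le> t" for t
  proof -
    have "Matrix.mat 1 1 (\<lambda>_. t) \<in> psd_mats 1"
    proof (rule psd_matsI)
      show "0 \<le> (\<Sum>i<1. \<Sum>j<1. x i * Matrix.mat 1 1 (\<lambda>_. t) $$ (i, j) * x j)" for x
        using mult_nonneg_nonneg[OF that zero_le_square[of "x 0"]] by (simp add: mult_ac)
    qed simp_all
    then show ?thesis
      unfolding corner_def using psd_mats_four_block_diag[OF _ psd_mats_zero, of _ 1 "nzeta S"] by simp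
  qed
  have corner_carrier: "corner t \<in> carrier_mat (nzeta S + 1) (nzeta S + 1)" for t
    unfolding corner_def add.commute[of "nzeta S" 1] by (rule four_block_carrier_mat) simp_all
  have corner_index: "corner t $$ (i, j) = (if i = 0 \<and> j = 0 then t else 0)"
    if "i < nzeta S + 1" "j < nzeta S + 1" for t i j
    unfolding corner_def using that by (subst index_mat_four_block) auto
  note corner_dim = carrier_matD[OF corner_carrier]
  have corner_sym: "corner t \<in> sym_mats (nzeta S + 1)" for t
    by (rule sym_matsI[OF corner_carrier]) (simp only: corner_index conj_commute)
  have comb: "a \<cdot>\<^sub>m corner s + b \<cdot>\<^sub>m corner t = corner (a * s + b * t)" for a b s t
    by (rule eq_matI) (simp_all add: corner_dim corner_index)
  have diff: "corner s - corner t = corner (s - t)" for s t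
    by (rule eq_matI) (simp_all add: corner_dim corner_index)
  have \<Sigma>: "Sigma_eps S \<in> psd_mats ?n"
    by (rule Sigma_eps_psd) fact
  note B = calBs_carrier[of S \<chi> p] calBs_carrier[of S \<chi>' p]
  have Q: "transpose_mat (calBs S \<chi> p) * Aj * calBs S \<chi> p \<in> carrier_mat ?n ?n" for \<chi>
    using calBs_carrier[of S \<chi> p] psd_mats_carrier[OF Aj]
    by (intro mult_carrier_mat[of _ _ "nw S"]) auto
  \<comment> \<open>The right side is collected into a single trace against
    \<open>Sigma_eps S\<close>, so that both sides compare two congruences of
    \<open>Aj\<close>.\<close>
  have "tr (\<lambda>c. \<mu> * \<chi> c + (1 - \<mu>) * \<chi>' c) \<le> \<mu> * tr \<chi> + (1 - \<mu>) * tr \<chi>'"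
    unfolding tr_def calBs_convex_comb trace_mult_lincomb[OF Q Q psd_mats_carrier[OF \<Sigma>], symmetric]
    by (rule trace_mult_mono[OF congruence_convex[OF Aj B \<mu>] \<Sigma>])
  then show ?thesis
    unfolding loewner_le_def H comb diff by (intro conjI corner_sym corner_psd) simp
qed

lemma mat_integrable_path:
  assumes chain: "markov_chain \<Omega> (hor S) m \<pi> P \<theta>"
    and cong: "\<And>p q. agree_on_horizon S p q \<Longrightarrow> X p = X q"
    and car: "\<And>p. X p \<in> carrier_mat nr nc"
  shows "mat_integrable \<Omega> nr nc (\<lambda>\<omega>. X (\<lambda>t. \<theta> t \<omega>))"
proof -
  have "integrable \<Omega> (\<lambda>\<omega>. X (\<lambda>t. \<theta> t \<omega>) $$ (i, j))" for i j
    by (rule integrable_path_functional[OF chain, of "\<lambda>p. X p $$ (i, j)"])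
      (metis cong agree_on_horizon_def)
  then show ?thesis
    using car by (simp add: mat_integrable_def)
qed

text \<open>\<open>calF\<close> is linear in the parameters and \<open>calG\<close> is free of them,
  so the expectation of \<open>calG\<close> is the constant part and that of \<open>calF\<close> the
  linear part.\<close>

lemma calM_affine:
  assumes chain: "markov_chain \<Omega> (hor S) m \<pi> P \<theta>"
  shows "affine_mat_on X (nw S) (nzeta S + 1) (calM S \<Omega> \<theta>)"
proof -
  let ?K = "mat_expectation \<Omega> (nw S) (nzeta S + 1) (\<lambda>\<omega>. calG S (\<lambda>t. \<theta> t \<omega>))"
  let ?L = "\<lambda>\<chi>. mat_expectation \<Omega> (nw S) (nzeta S + 1) (\<lambda>\<omega>. calF S \<chi> (\<lambda>t. \<theta> t \<omega>))"
  have F: "mat_integrable \<Omega> (nw S) (nzeta S + 1) (\<lambda>\<omega>. calF S \<chi> (\<lambda>t. \<theta> t \<omega>))" for \<chi>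
    by (rule mat_integrable_path[OF chain calF_cong calF_carrier])
  have G: "mat_integrable \<Omega> (nw S) (nzeta S + 1) (\<lambda>\<omega>. calG S (\<lambda>t. \<theta> t \<omega>))"
    by (rule mat_integrable_path[OF chain calG_cong calG_carrier])
  have lincomb: "?L (\<lambda>c. a * \<chi> c + b * \<chi>' c) = a \<cdot>\<^sub>m ?L \<chi> + b \<cdot>\<^sub>m ?L \<chi>'" for a b \<chi> \<chi>'
    unfolding calF_lincomb by (rule mat_expectation_lincomb[OF F F])
  have add: "?L (\<lambda>c. \<chi> c + \<chi>' c) = ?L \<chi> + ?L \<chi>'" for \<chi> \<chi>'
    using lincomb[of 1 \<chi> 1 \<chi>'] by (simp add: one_smult_mat)
  have smult: "?L (\<lambda>c. a * \<chi> c) = a \<cdot>\<^sub>m ?L \<chi>" for a \<chi>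
  proof -
    have "a \<cdot>\<^sub>m ?L \<chi> + 0 \<cdot>\<^sub>m ?L \<chi> = a \<cdot>\<^sub>m ?L \<chi>"
      by (rule eq_matI) (auto simp: mat_expectation_def)
    then show ?thesis
      using lincomb[of a \<chi> 0 \<chi>] by simp
  qed
  have "calM S \<Omega> \<theta> \<chi> = ?K + ?L \<chi>" for \<chi>
    unfolding calM_def mat_expectation_add[OF F G]
    by (rule comm_add_mat[of _ "nw S" "nzeta S + 1"]) simp_all
  then show ?thesis
    unfolding affine_mat_on_def
    by (intro bexI[of _ ?K] exI[of _ ?L] conjI ballI allI add smult mat_expectation_carrier)
qed

text \<open>The quadratic term and the trace term are each compared path by path, then integrated;
  adding the two inequalities gives the claim.\<close>

lemma calV_convex:
  assumes wf: "well_formed S" and chain: "markov_chain \<Omega> (hor S) m \<pi> P \<theta>"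
    and Aj: "Aj \<in> psd_mats (nw S)" and \<mu>: "\<mu> \<in> {0..1}"
  shows "loewner_le (nzeta S + 1) (calV S \<Omega> \<theta> Aj (\<lambda>c. \<mu> * \<chi> c + (1 - \<mu>) * \<chi>' c))
    (\<mu> \<cdot>\<^sub>m calV S \<Omega> \<theta> Aj \<chi> + (1 - \<mu>) \<cdot>\<^sub>m calV S \<Omega> \<theta> Aj \<chi>')"
proof -
  let ?n = "nzeta S + 1"
  let ?E = "\<lambda>Y. mat_expectation \<Omega> ?n ?n (\<lambda>\<omega>. Y (\<lambda>t. \<theta> t \<omega>))"
  define W where "W \<chi> p = calF S \<chi> p + calG S p" for \<chi> p
  define Q where "Q \<chi> p = transpose_mat (W \<chi> p) * Aj * W \<chi> p" for \<chi> p
  let ?\<chi> = "\<lambda>c. \<mu> * \<chi> c + (1 - \<mu>) * \<chi>' c"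
  have W: "W \<chi> p \<in> carrier_mat (nw S) ?n" for \<chi> p
    unfolding W_def by (intro add_carrier_mat calG_carrier)
  have W_comb: "W ?\<chi> p = \<mu> \<cdot>\<^sub>m W \<chi> p + (1 - \<mu>) \<cdot>\<^sub>m W \<chi>' p" for p
    unfolding W_def calF_lincomb by (rule convex_comb_add_const[OF calF_carrier calF_carrier calG_carrier])
  have Q_carrier: "Q \<chi> p \<in> carrier_mat ?n ?n" for \<chi> p
    unfolding Q_def using W psd_mats_carrier[OF Aj] by (intro mult_carrier_mat[of _ _ "nw S"]) auto
  have Q: "mat_integrable \<Omega> ?n ?n (\<lambda>\<omega>. Q \<chi> (\<lambda>t. \<theta> t \<omega>))" for \<chi>
    by (rule mat_integrable_path[OF chain _ Q_carrier]) (simp only: Q_def W_def calF_cong calG_cong)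
  have H: "mat_integrable \<Omega> ?n ?n (\<lambda>\<omega>. calH S Aj \<chi> (\<lambda>t. \<theta> t \<omega>))" for \<chi>
    by (rule mat_integrable_path[OF chain calH_cong calH_carrier])
  have V: "calV S \<Omega> \<theta> Aj \<chi> = ?E (Q \<chi>) + ?E (calH S Aj \<chi>)" for \<chi>
    by (simp add: calV_def Q_def W_def)
  have "loewner_le ?n (?E (Q ?\<chi>)) (\<mu> \<cdot>\<^sub>m ?E (Q \<chi>) + (1 - \<mu>) \<cdot>\<^sub>m ?E (Q \<chi>'))"
    \<comment> \<open>Writing the right side as one expectation makes the monotonicity of
      expectations applicable, with a pathwise inequality as remaining goal.\<close>
    unfolding mat_expectation_lincomb[OF Q Q, symmetric]
  proof (rule mat_expectation_mono[OF Q mat_integrable_lincomb[OF Q Q]])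
    show "loewner_le ?n (Q ?\<chi> (\<lambda>t. \<theta> t \<omega>)) (\<mu> \<cdot>\<^sub>m Q \<chi> (\<lambda>t. \<theta> t \<omega>) + (1 - \<mu>) \<cdot>\<^sub>m Q \<chi>' (\<lambda>t. \<theta> t \<omega>))" for \<omega>
      unfolding Q_def W_comb by (rule congruence_convex[OF Aj W W \<mu>])
  qed
  moreover have "loewner_le ?n (?E (calH S Aj ?\<chi>)) (\<mu> \<cdot>\<^sub>m ?E (calH S Aj \<chi>) + (1 - \<mu>) \<cdot>\<^sub>m ?E (calH S Aj \<chi>'))"
    unfolding mat_expectation_lincomb[OF H H, symmetric]
    by (rule mat_expectation_mono[OF H mat_integrable_lincomb[OF H H] calH_convex[OF wf Aj \<mu>]])
  ultimately have "loewner_le ?n (calV S \<Omega> \<theta> Aj ?\<chi>)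
      ((\<mu> \<cdot>\<^sub>m ?E (Q \<chi>) + (1 - \<mu>) \<cdot>\<^sub>m ?E (Q \<chi>')) +
       (\<mu> \<cdot>\<^sub>m ?E (calH S Aj \<chi>) + (1 - \<mu>) \<cdot>\<^sub>m ?E (calH S Aj \<chi>')))"
    unfolding V by (rule loewner_le_add)
  also have "(\<mu> \<cdot>\<^sub>m ?E (Q \<chi>) + (1 - \<mu>) \<cdot>\<^sub>m ?E (Q \<chi>')) +
       (\<mu> \<cdot>\<^sub>m ?E (calH S Aj \<chi>) + (1 - \<mu>) \<cdot>\<^sub>m ?E (calH S Aj \<chi>')) =
      \<mu> \<cdot>\<^sub>m calV S \<Omega> \<theta> Aj \<chi> + (1 - \<mu>) \<cdot>\<^sub>m calV S \<Omega> \<theta> Aj \<chi>'"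
    unfolding V by (rule eq_matI) (auto simp: mat_expectation_def distrib_left)
  finally show ?thesis .
qed

theorem proposition2:
  fixes S :: system
    and \<Omega> :: "'w measure"
    and \<pi> :: "nat \<Rightarrow> real"
    and P :: "nat \<Rightarrow> nat \<Rightarrow> real"
    and \<theta> :: "nat \<Rightarrow> 'w \<Rightarrow> nat"
    and Aj :: "real mat"
  assumes "well_formed S"
    and "markov_chain \<Omega> (hor S) (modes S) \<pi> P \<theta>"
    and "Aj \<in> psd_mats (nw S)"
  shows "affine_mat_on (policy_space S) (nw S) (nzeta S + 1) (calM S \<Omega> \<theta>) \<and>
    (\<forall>\<chi> \<in> policy_space S. \<forall>\<chi>' \<in> policy_space S. \<forall>\<mu> \<in> {0..1}.
       loewner_le (nzeta S + 1)
         (calV S \<Omega> \<theta> Aj (\<lambda>c. \<mu> * \<chi> c + (1 - \<mu>) * \<chi>' c))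
         (\<mu> \<cdot>\<^sub>m calV S \<Omega> \<theta> Aj \<chi> + (1 - \<mu>) \<cdot>\<^sub>m calV S \<Omega> \<theta> Aj \<chi>'))"
  using calM_affine[OF assms(2)] calV_convex[OF assms(1-3)] by blast

end
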